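(* Let $p\in(0,1)$ and let $\hat S$ and $\check S$ be the positively and negatively step-reinforced random walks with reinforcement parameter $p$ built from i.i.d. variables $X_1,X_2,\dots$ If $\mathbb{E}|X_1|<\infty$, then, with $m_1=\mathbb{E}(X_1)$, as $n\to\infty$, $$\frac{\hat S(n)}{n}\to m_1\ \text{ a.s.}\qquad\text{and}\qquad \frac{\check S(n)}{n}\to \frac{1-p}{1+p}\,m_1\ \text{ a.s.}$$
   Context: Let $\{X_n,n\ge1\}$ be i.i.d. real random variables, $\{\varepsilon_n,n\ge2\}$ i.i.d. Bernoulli variables with parameter $p$ (so $\mathbb{P}(\varepsilon_n=1)=p$), and for $n\ge2$ let $U_n$ be uniformly distributed on $\{1,\dots,n-1\}$; all the variables $X_1,X_2,\varepsilon_2,U_2,X_3,\varepsilon_3,U_3,\dots$ are independent. Positively step-reinforced walk: $\hat X_1=X_1$ and for $n\ge2$, $\hat X_n=X_n$ if $\varepsilon_n=0$, $\hat X_n=\hat X_{U_n}$ if $\varepsilon_n=1$; $\hat S(n)=\hat X_1+\dots+\hat X_n$. Negatively step-reinforced walk: $\check X_1=X_1$ and for $n\ge2$, $\check X_n=X_n$ if $\varepsilon_n=0$, $\check X_n=-\check X_{U_n}$ if $\varepsilon_n=1$; $\check S(n)=\check X_1+\dots+\check X_n$. *)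

theory Defs
  imports "HOL-Probability.Probability"
begin

datatype source = Step nat | Reinforce nat | Choice nat

definition sources :: "source set" where
  "sources = Step ` {1..} \<union> Reinforce ` {2..} \<union> Choice ` {2..}"

(* indep_vars requires a common value type, so the Boolean and natural number variables are
   embedded into the reals. Both embeddings are injective with discrete image, hence the
   generated sigma-algebras are unchanged. *)
fun source_var ::
  "(nat \<Rightarrow> 'a \<Rightarrow> real) \<Rightarrow> (nat \<Rightarrow> 'a \<Rightarrow> bool) \<Rightarrow> (nat \<Rightarrow> 'a \<Rightarrow> nat) \<Rightarrow> source \<Rightarrow> 'a \<Rightarrow> real"
where
  "source_var X \<epsilon> U (Step n) = X n"
| "source_var X \<epsilon> U (Reinforce n) = (\<lambda>\<omega>. of_bool (\<epsilon> n \<omega>))"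
| "source_var X \<epsilon> U (Choice n) = (\<lambda>\<omega>. real (U n \<omega>))"

(* The event that the n-th Bernoulli variable equals 1 is written \<epsilon> n \<omega>. *)
locale step_reinforcement = prob_space M for M :: "'a measure" +
  fixes p :: real
    and X :: "nat \<Rightarrow> 'a \<Rightarrow> real"
    and \<epsilon> :: "nat \<Rightarrow> 'a \<Rightarrow> bool"
    and U :: "nat \<Rightarrow> 'a \<Rightarrow> nat"
  assumes X_measurable: "n \<ge> 1 \<Longrightarrow> random_variable borel (X n)"
    and \<epsilon>_measurable: "n \<ge> 2 \<Longrightarrow> random_variable (count_space UNIV) (\<epsilon> n)"
    and U_measurable: "n \<ge> 2 \<Longrightarrow> random_variable (count_space UNIV) (U n)"
    and X_distr: "n \<ge> 1 \<Longrightarrow> distr M borel (X n) = distr M borel (X 1)"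
    and \<epsilon>_distr: "n \<ge> 2 \<Longrightarrow> distr M (count_space UNIV) (\<epsilon> n) = measure_pmf (bernoulli_pmf p)"
    and U_distr: "n \<ge> 2 \<Longrightarrow> distr M (count_space UNIV) (U n) = measure_pmf (pmf_of_set {1..n-1})"
    and indep: "indep_vars (\<lambda>_. borel) (source_var X \<epsilon> U) sources"

(* The steps are defined path by path from sequences x, e, u. The guard u n \<in> {1..n-1} makes the
   recursion total; on the null event where U leaves its range the step is taken to be x n. *)
function pos_reinforced_step ::
  "(nat \<Rightarrow> real) \<Rightarrow> (nat \<Rightarrow> bool) \<Rightarrow> (nat \<Rightarrow> nat) \<Rightarrow> nat \<Rightarrow> real"
where
  "pos_reinforced_step x e u n =
     (if n \<ge> 2 \<and> e n \<and> u n \<in> {1..n-1} then pos_reinforced_step x e u (u n) else x n)"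
  by pat_completeness auto
termination by (relation "Wellfounded.measure (\<lambda>(x, e, u, n). n)") auto

function neg_reinforced_step ::
  "(nat \<Rightarrow> real) \<Rightarrow> (nat \<Rightarrow> bool) \<Rightarrow> (nat \<Rightarrow> nat) \<Rightarrow> nat \<Rightarrow> real"
where
  "neg_reinforced_step x e u n =
     (if n \<ge> 2 \<and> e n \<and> u n \<in> {1..n-1} then - neg_reinforced_step x e u (u n) else x n)"
  by pat_completeness auto
termination by (relation "Wellfounded.measure (\<lambda>(x, e, u, n). n)") auto

declare pos_reinforced_step.simps [simp del] neg_reinforced_step.simps [simp del]

definition X_hat ::
  "(nat \<Rightarrow> 'a \<Rightarrow> real) \<Rightarrow> (nat \<Rightarrow> 'a \<Rightarrow> bool) \<Rightarrow> (nat \<Rightarrow> 'a \<Rightarrow> nat) \<Rightarrow> nat \<Rightarrow> 'a \<Rightarrow> real" where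
  "X_hat X \<epsilon> U n \<omega> = pos_reinforced_step (\<lambda>k. X k \<omega>) (\<lambda>k. \<epsilon> k \<omega>) (\<lambda>k. U k \<omega>) n"

definition X_check ::
  "(nat \<Rightarrow> 'a \<Rightarrow> real) \<Rightarrow> (nat \<Rightarrow> 'a \<Rightarrow> bool) \<Rightarrow> (nat \<Rightarrow> 'a \<Rightarrow> nat) \<Rightarrow> nat \<Rightarrow> 'a \<Rightarrow> real" where
  "X_check X \<epsilon> U n \<omega> = neg_reinforced_step (\<lambda>k. X k \<omega>) (\<lambda>k. \<epsilon> k \<omega>) (\<lambda>k. U k \<omega>) n"

definition S_hat ::
  "(nat \<Rightarrow> 'a \<Rightarrow> real) \<Rightarrow> (nat \<Rightarrow> 'a \<Rightarrow> bool) \<Rightarrow> (nat \<Rightarrow> 'a \<Rightarrow> nat) \<Rightarrow> nat \<Rightarrow> 'a \<Rightarrow> real" where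
  "S_hat X \<epsilon> U n \<omega> = (\<Sum>k=1..n. X_hat X \<epsilon> U k \<omega>)"

definition S_check ::
  "(nat \<Rightarrow> 'a \<Rightarrow> real) \<Rightarrow> (nat \<Rightarrow> 'a \<Rightarrow> bool) \<Rightarrow> (nat \<Rightarrow> 'a \<Rightarrow> nat) \<Rightarrow> nat \<Rightarrow> 'a \<Rightarrow> real" where
  "S_check X \<epsilon> U n \<omega> = (\<Sum>k=1..n. X_check X \<epsilon> U k \<omega>)"

lemma X_hat_1: "X_hat X \<epsilon> U 1 \<omega> = X 1 \<omega>"
  by (simp add: X_hat_def pos_reinforced_step.simps)

lemma X_check_1: "X_check X \<epsilon> U 1 \<omega> = X 1 \<omega>"
  by (simp add: X_check_def neg_reinforced_step.simps)

context step_reinforcement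
begin

lemma AE_U_range:
  assumes "n \<ge> 2"
  shows "AE \<omega> in M. U n \<omega> \<in> {1..n-1}"
proof -
  have "set_pmf (pmf_of_set {1..n-1}) = {1..n-1}"
    using assms by (intro set_pmf_of_set) auto
  then have "AE k in distr M (count_space UNIV) (U n). k \<in> {1..n-1}"
    unfolding U_distr[OF assms] AE_measure_pmf_iff by simp
  then show ?thesis
    by (subst (asm) AE_distr_iff[OF U_measurable[OF assms]]) auto
qed

lemma AE_X_hat_rec:
  assumes "n \<ge> 2"
  shows "AE \<omega> in M. X_hat X \<epsilon> U n \<omega> = (if \<epsilon> n \<omega> then X_hat X \<epsilon> U (U n \<omega>) \<omega> else X n \<omega>)"
  using AE_U_range[OF assms]
proof eventually_elim
  case (elim \<omega>)
  then show ?case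
    using assms unfolding X_hat_def by (subst pos_reinforced_step.simps) auto
qed

lemma AE_X_check_rec:
  assumes "n \<ge> 2"
  shows "AE \<omega> in M. X_check X \<epsilon> U n \<omega> = (if \<epsilon> n \<omega> then - X_check X \<epsilon> U (U n \<omega>) \<omega> else X n \<omega>)"
  using AE_U_range[OF assms]
proof eventually_elim
  case (elim \<omega>)
  then show ?case
    using assms unfolding X_check_def by (subst neg_reinforced_step.simps) auto
qed

end

end

theory Submission
  imports Defs
begin

text \<open>
  Let \<open>s = 1\<close> for the positive and \<open>s = -1\<close> for the negative walk. Given the past, a step has mean
  \<open>(1 - p) * m + p * s * S(n) / n\<close>, which yields linear recursions for the mean and the variance of
  \<open>S(n)\<close>. Truncating the \<open>k\<close>-th variable at level \<open>k\<close> makes the variances finite, and the recursion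
  shows that the sum of \<open>Var(S(n)) / n^3\<close> converges, so that almost surely the sum of
  \<open>((S(n) - E S(n)) / n)^2 / n\<close> does. For a nondecreasing walk this forces \<open>S(n) / n\<close> to converge; the
  general case is reduced to that one by adding and subtracting the positively reinforced walk with
  absolute values as steps. Almost surely truncation alters finitely many variables, and each of
  them contributes \<open>o(n)\<close>, because the walk whose only nonzero fresh step is the \<open>i\<close>-th one is
  covered by the same argument with limit \<open>0\<close>.
\<close>

section \<open>Real sequences and series\<close>

text \<open>With only a first moment, \<open>Var(S(n))\<close> need not be of order
  \<open>n\<close>, and for \<open>p > 1/2\<close> copying alone can make it grow like
  \<open>n^(2p)\<close> for the positive walk. What survives for every \<open>p < 1\<close> is that
  \<open>n^(2p)\<close> is slower than \<open>n^2\<close>: after division by \<open>n^2\<close> the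
  factor \<open>1 + 2p/n\<close> of the variance recursion leaves a contraction of order
  \<open>(1 - p)/n\<close>. This gives a convergent series but no rate, hence the appeal to
  monotonicity. The limit is the fixed point of the drift,
  \<open>x = (1 - p) * m + p * s * x\<close>, that is \<open>x = (1 - p) / (1 - p * s) * m\<close>.
  Undoing the truncation is harder than for independent summands: an altered variable can be copied
  again and again, so finitely many alterations may change infinitely many steps. For a fixed
  copying pattern their effect is linear in the altered values, so each index can be treated
  separately.\<close>

lemma summable_div_Suc_if_recursive_le:
  fixes w r :: "nat \<Rightarrow> real"
  assumes "\<theta> > 0" and w: "\<And>n. w n \<ge> 0" and r: "\<And>n. r n \<ge> 0" "summable r"
    and rec: "\<And>n. n \<ge> N \<Longrightarrow> w (Suc n) \<le> (1 - \<theta> / real (Suc n)) * w n + r n"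
  shows "summable (\<lambda>n. w n / real (Suc n))"
proof -
  \<comment> \<open>The recursion bounds \<open>\<theta> * w n / (n + 1)\<close> by
    \<open>w n - w (n + 1) + r n\<close>. The differences telescope, and the last \<open>w\<close>
    is dropped because it is nonnegative.\<close>
  have tel: "\<theta> * (\<Sum>n<k. w (n + N) / real (Suc (n + N))) \<le> w N - w (k + N) + (\<Sum>n<k. r (n + N))" for k
  proof (induction k)
    case (Suc k)
    have "\<theta> * (w (k + N) / real (Suc (k + N))) \<le> w (k + N) - w (Suc k + N) + r (k + N)"
      using rec[of "k + N"] by (simp add: algebra_simps)
    with Suc show ?case by (simp add: distrib_left)
  qed simp
  have "summable (\<lambda>n. w (n + N) / real (Suc (n + N)))"
  proof (rule summableI_nonneg_bounded)
    fix k
    have "(\<Sum>n<k. r (n + N)) \<le> suminf (\<lambda>n. r (n + N))"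
      using r by (intro sum_le_suminf summable_ignore_initial_segment) auto
    with tel[of k] w[of "k + N"]
    have "\<theta> * (\<Sum>n<k. w (n + N) / real (Suc (n + N))) \<le> w N + suminf (\<lambda>n. r (n + N))" by linarith
    then show "(\<Sum>n<k. w (n + N) / real (Suc (n + N))) \<le> (w N + suminf (\<lambda>n. r (n + N))) / \<theta>"
      using \<open>\<theta> > 0\<close> by (simp add: pos_le_divide_eq mult.commute)
  qed (use w in simp)
  then show ?thesis by (subst (asm) summable_iff_shift)
qed

lemma not_summable_const_div_Suc:
  assumes "(c::real) \<noteq> 0"
  shows "\<not> summable (\<lambda>n. c / real (Suc n))"
proof
  assume "summable (\<lambda>n. c / real (Suc n))"
  from summable_mult[OF this, of "1 / c"] have "summable (\<lambda>n. inverse (real (Suc n)))"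
    using assms by (simp add: inverse_eq_divide del: of_nat_Suc)
  then have "summable (\<lambda>n. inverse (real n))" by (subst (asm) summable_Suc_iff)
  then show False using not_summable_harmonic by blast
qed

text \<open>Once \<open>b\<close> is within \<open>h\<close> of \<open>c\<close>, the excess
  \<open>g n\<close> of \<open>\<bar>a n - c\<bar>\<close> over \<open>h\<close> obeys the
  homogeneous recursion, so the series of \<open>g n / (n + 1)\<close> converges. Divergence of the
  harmonic series forces \<open>g\<close> below \<open>h\<close> at some index, and it stays there
  because it no longer increases. The bounds on \<open>\<theta>\<close> make
  \<open>\<theta> / (n + 1)\<close> a weight in \<open>[0, 1]\<close> for
  \<open>n \<ge> 1\<close>.\<close>

lemma tendsto_weighted_average:
  fixes a b :: "nat \<Rightarrow> real"
  assumes \<theta>: "0 < \<theta>" "\<theta> < 2" and b: "b \<longlonglongrightarrow> c"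
    and rec: "\<And>n. n \<ge> 1 \<Longrightarrow> a (Suc n) = (1 - \<theta> / real (Suc n)) * a n + \<theta> / real (Suc n) * b n"
  shows "a \<longlonglongrightarrow> c"
proof (rule LIMSEQ_I)
  fix e :: real assume "e > 0"
  define h where "h = e / 2"
  have h: "h > 0" using \<open>e > 0\<close> by (simp add: h_def)
  define g where "g n = max (\<bar>a n - c\<bar> - h) 0" for n
  from LIMSEQ_D[OF b h] obtain N where N: "\<And>n. n \<ge> N \<Longrightarrow> \<bar>b n - c\<bar> < h" by auto
  have g_rec: "g (Suc n) \<le> (1 - \<theta> / real (Suc n)) * g n" if n: "n \<ge> max N 1" for n
  proof -
    define t where "t = \<theta> / real (Suc n)"
    have t: "0 \<le> t" "t \<le> 1" using \<theta> n by (auto simp: t_def field_simps)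
    have "a (Suc n) = (1 - t) * a n + t * b n" using rec[of n] n by (simp add: t_def)
    then have "\<bar>a (Suc n) - c\<bar> = \<bar>(1 - t) * (a n - c) + t * (b n - c)\<bar>"
      by (simp add: algebra_simps)
    also have "\<dots> \<le> (1 - t) * \<bar>a n - c\<bar> + t * \<bar>b n - c\<bar>"
      using t by (intro order.trans[OF abs_triangle_ineq]) (simp add: abs_mult)
    also have "\<dots> \<le> (1 - t) * \<bar>a n - c\<bar> + t * h"
      using N[of n] n t by (intro add_left_mono mult_left_mono) auto
    finally have "\<bar>a (Suc n) - c\<bar> - h \<le> (1 - t) * (\<bar>a n - c\<bar> - h)" by (simp add: algebra_simps)
    also have "\<dots> \<le> (1 - t) * g n" using t by (intro mult_left_mono) (auto simp: g_def)
    finally show ?thesis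
      unfolding t_def[symmetric] using t by (subst g_def) (auto intro: mult_nonneg_nonneg simp: g_def)
  qed
  have g0: "g n \<ge> 0" for n by (simp add: g_def)
  have sg: "summable (\<lambda>n. g n / real (Suc n))"
    by (rule summable_div_Suc_if_recursive_le[OF \<theta>(1) g0, of "\<lambda>_. 0" "max N 1"]) (use g_rec in auto)
  have dec: "g (m + k) \<le> g m" if "m \<ge> max N 1" for m k
  proof (induction k)
    case (Suc k)
    have "g (Suc (m + k)) \<le> (1 - \<theta> / real (Suc (m + k))) * g (m + k)" using that by (intro g_rec) simp
    also have "\<dots> \<le> 1 * g (m + k)" using g0 \<theta> by (intro mult_right_mono) auto
    finally show ?case using Suc by simp
  qed simp
  have "\<exists>m \<ge> max N 1. g m < h"
  proof (rule ccontr)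
    assume "\<not> ?thesis"
    then have "\<forall>n\<ge>max N 1. norm (h / real (Suc n)) \<le> g n / real (Suc n)"
      using h by (auto simp: divide_right_mono not_less)
    then have "summable (\<lambda>n. h / real (Suc n))" by (intro summable_comparison_test[OF _ sg] exI)
    then show False using not_summable_const_div_Suc[of h] h by simp
  qed
  then obtain m where m: "m \<ge> max N 1" "g m < h" by auto
  show "\<exists>no. \<forall>n\<ge>no. norm (a n - c) < e"
  proof (intro exI[of _ m] allI impI)
    fix n assume "m \<le> n"
    then have "g n < h" using dec[OF m(1), of "n - m"] m(2) by simp
    then show "norm (a n - c) < e" unfolding g_def h_def max_less_iff_conj by simp
  qed
qed

text \<open>If \<open>T n / n\<close> is off by \<open>e\<close> at some \<open>n\<close>, monotonicity keeps it off by \<open>e / 2\<close> on a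
  block of indices around \<open>n\<close> whose length is proportional to \<open>n\<close>, which costs a fixed amount of
  the convergent series.\<close>

lemma mono_div_tendsto_if_summable_sq:
  fixes T c :: "nat \<Rightarrow> real"
  assumes T: "mono T" "\<And>n. T n \<ge> 0" and c: "c \<longlonglongrightarrow> l" "l \<ge> 0"
    and sm: "summable (\<lambda>n. (T n / real n - c n)\<^sup>2 / real (Suc n))"
  shows "(\<lambda>n. T n / real n) \<longlonglongrightarrow> l"
proof (rule LIMSEQ_I)
  fix e :: real assume e: "e > 0"
  define g where "g n = (T n / real n - c n)\<^sup>2 / real (Suc n)" for n
  \<comment> \<open>\<open>d\<close> is the relative length of a block. The second argument of the
    minimum gives \<open>(1 + d) * (l + e/2) \<le> l + e\<close>, so a value
    \<open>T n \<ge> (l + e) * n\<close> remains too large up to index \<open>(1 + d) * n\<close>.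
    The first keeps a block that ends at \<open>n\<close> from reaching below
    \<open>n / 2\<close>.\<close>
  define d where "d = min (1/2) ((e/2) / (l + e/2))"
  have pos: "l + e/2 > 0" using e c by simp
  have d: "0 < d" "d \<le> 1/2" "d * (l + e/2) \<le> e/2"
  proof -
    show "0 < d" using e pos by (simp add: d_def)
    show "d \<le> 1/2" unfolding d_def by (rule min.cobounded1)
    have "d \<le> (e/2) / (l + e/2)" by (simp add: d_def)
    then show "d * (l + e/2) \<le> e/2" using pos by (subst (asm) pos_le_divide_eq) auto
  qed
  \<comment> \<open>\<open>q\<close> is a lower bound for the sum of \<open>g\<close> over a block:
    there are more than \<open>d * n\<close> indices \<open>m\<close>, each with
    \<open>m + 1 \<le> 3 * n\<close>, and \<open>T m / m\<close> misses \<open>c m\<close> by at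
    least \<open>e/4\<close>, as \<open>c m\<close> is within \<open>e/4\<close> of
    \<open>l\<close>.\<close>
  define q where "q = d * (e/4)\<^sup>2 / 3"
  have q: "q > 0" using d e by (simp add: q_def)
  have "\<exists>N. \<forall>n\<ge>N. norm (c n - l) < e/4" by (rule LIMSEQ_D[OF c(1)]) (use e in simp)
  then obtain N1 where N1: "\<And>n. n \<ge> N1 \<Longrightarrow> \<bar>c n - l\<bar> < e/4" by auto
  have "summable g" using sm by (simp add: g_def[abs_def])
  with q have "\<exists>N. \<forall>m\<ge>N. \<forall>n. norm (sum g {m..<n}) < q" by (simp only: summable_Cauchy)
  then obtain N2 where N2: "\<And>m n. m \<ge> N2 \<Longrightarrow> norm (sum g {m..<n}) < q" by blast
  \<comment> \<open>Monotonicity carries a value that is too large to later indices and one that is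
    too small to earlier indices; accordingly the block starts at \<open>n\<close> or ends
    there.\<close>
  have block: False
    if n: "n \<ge> 2 * max N1 N2 + 2" and k: "k = nat \<lfloor>d * real n\<rfloor>" and a: "a = n \<or> a = n - k"
      and off: "\<And>m. m \<in> {a..<Suc (a + k)} \<Longrightarrow> \<bar>T m / real m - l\<bar> \<ge> e/2" for n k a
  proof -
    have kr: "real k \<le> d * real n" "d * real n < real k + 1"
      using d by (auto simp: k)
    have kn: "real k \<le> real n / 2" using kr(1) d(2) mult_right_mono[of d "1/2" "real n"] by simp
    then have kn': "2 * k \<le> n" by linarith
    have aN: "a \<ge> max N1 N2" using a n kn' by auto
    have up: "real (Suc m) \<le> 3 * real n" if "m \<in> {a..<Suc (a + k)}" for m
    proof -
      have "Suc m \<le> 3 * n" using that a kn' n by auto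
      then show ?thesis by (metis of_nat_le_iff of_nat_mult of_nat_numeral)
    qed
    have "q \<le> (real k + 1) * ((e/4)\<^sup>2 / (3 * real n))"
    proof -
      have "q = (d * real n) * ((e/4)\<^sup>2 / (3 * real n))" using n by (simp add: q_def)
      also have "\<dots> \<le> (real k + 1) * ((e/4)\<^sup>2 / (3 * real n))"
        using kr(2) by (intro mult_right_mono) auto
      finally show ?thesis .
    qed
    also have "\<dots> = (\<Sum>m\<in>{a..<Suc (a + k)}. (e/4)\<^sup>2 / (3 * real n))" by simp
    also have "\<dots> \<le> sum g {a..<Suc (a + k)}"
    proof (rule sum_mono)
      fix m assume m: "m \<in> {a..<Suc (a + k)}"
      have "\<bar>c m - l\<bar> < e/4" using N1 m aN by auto
      with off[OF m] have "e/4 \<le> \<bar>T m / real m - c m\<bar>" by linarith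
      then have "(e/4)\<^sup>2 \<le> (T m / real m - c m)\<^sup>2"
        using e by (metis abs_le_square_iff abs_of_pos divide_pos_pos zero_less_numeral)
      then show "(e/4)\<^sup>2 / (3 * real n) \<le> g m"
        unfolding g_def using up[OF m] n by (intro frac_le) auto
    qed
    finally have "q \<le> sum g {a..<Suc (a + k)}" .
    then show False using N2[of a "Suc (a + k)"] aN by (simp add: abs_less_iff del: sum.op_ivl_Suc)
  qed
  show "\<exists>no. \<forall>n\<ge>no. norm (T n / real n - l) < e"
  proof (intro exI[of _ "2 * max N1 N2 + 2"] allI impI, rule ccontr)
    fix n assume n: "n \<ge> 2 * max N1 N2 + 2" and "\<not> norm (T n / real n - l) < e"
    then have alt: "T n / real n \<ge> l + e \<or> T n / real n \<le> l - e" by auto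
    define k where "k = nat \<lfloor>d * real n\<rfloor>"
    have kr: "real k \<le> d * real n" using d by (auto simp: k_def)
    have kn: "real k \<le> real n / 2" using kr(1) d(2) mult_right_mono[of d "1/2" "real n"] by simp
    from alt show False
    proof
      assume *: "T n / real n \<ge> l + e"
      show False
      proof (rule block[OF n k_def, of n])
        fix m assume m: "m \<in> {n..<Suc (n + k)}"
        have m0: "real m > 0" "real m \<le> (1 + d) * real n" using m n kr by (auto simp: algebra_simps)
        have "(l + e/2) * real m \<le> (l + e/2) * ((1 + d) * real n)"
          using m0 pos by (intro mult_left_mono) auto
        also have "\<dots> = ((l + e/2) + d * (l + e/2)) * real n" by (simp add: algebra_simps)
        also have "\<dots> \<le> (l + e) * real n" using d(3) by (intro mult_right_mono) auto
        also have "\<dots> \<le> T n" using * n by (simp add: pos_le_divide_eq)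
        also have "\<dots> \<le> T m" using T(1) m by (auto simp: mono_def)
        finally show "e/2 \<le> \<bar>T m / real m - l\<bar>" using m0 
          by (intro order.trans[OF _ abs_ge_self]) (simp add: pos_le_divide_eq le_diff_eq add.commute)
      qed simp
    next
      assume *: "T n / real n \<le> l - e"
      show False
      proof (rule block[OF n k_def, of "n - k"])
        fix m assume m: "m \<in> {n - k..<Suc (n - k + k)}"
        have "real k \<le> real n" using kn by simp
        then have m1: "real m \<ge> real n - real k" "m \<le> n" using m by auto
        have m0: "real m > 0" using m1 kn n by linarith
        \<comment> \<open>A value below \<open>l - e\<close> is possible only if
          \<open>l \<ge> e\<close>, since \<open>T\<close> is nonnegative. Hence inequalities may be
          multiplied by \<open>l - e/2\<close>.\<close>
        have "T n / real n \<ge> 0" using T(2) by simp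
        then have le: "l - e/2 \<ge> 0" using * e by linarith
        have d': "d * (l - e/2) \<le> e/2"
          by (rule order.trans[OF mult_left_mono d(3)]) (use d e in auto)
        have "T m \<le> T n" using T(1) m1 by (auto simp: mono_def)
        also have "\<dots> \<le> (l - e) * real n" using * n by (simp add: pos_divide_le_eq)
        also have "\<dots> \<le> ((l - e/2) - d * (l - e/2)) * real n"
          using d' by (intro mult_right_mono) auto
        also have "\<dots> = (l - e/2) * (real n - d * real n)" by (simp add: algebra_simps)
        also have "\<dots> \<le> (l - e/2) * real m" using kr m1 le by (intro mult_left_mono) auto
        finally have "T m / real m \<le> l - e/2" using m0 by (simp add: pos_divide_le_eq)
        then show "e/2 \<le> \<bar>T m / real m - l\<bar>" by linarith
      qed simp
    qed
  qed
qed

section \<open>Series controlled by a first moment\<close>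

lemma sum_inverse_squares_tail_le:
  assumes "N \<ge> 1"
  shows "(\<Sum>n=N..<N+k. 1 / (real n)\<^sup>2) \<le> 2 / real N"
proof -
  have "(\<Sum>n=N..<N+k. 1 / (real n)\<^sup>2) \<le> 2 / real N - 2 / real (N + k)"
  proof (induction k)
    case (Suc k)
    define x where "x = real (N + k)"
    have x: "x \<ge> 1" using assms by (simp add: x_def)
    \<comment> \<open>The right side is \<open>2 / (x * (x + 1))\<close>, and
      \<open>x + 1 \<le> 2 * x\<close> for \<open>x \<ge> 1\<close>; the constant 2 thus works from
      \<open>N = 1\<close> on.\<close>
    have "1 / x\<^sup>2 \<le> 2 / x - 2 / (x + 1)"
      using x by (simp add: divide_simps power2_eq_square)
    then show ?case using Suc by (simp add: x_def add.commute)
  qed simp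
  then show ?thesis by (smt (verit) divide_nonneg_nonneg of_nat_0_le_iff)
qed

text \<open>For \<open>x \<noteq> 0\<close> the nonzero terms start at the least integer
  \<open>N \<ge> \<bar>x\<bar>\<close>, and that tail is at most \<open>x^2 * 2 / N\<close>. The
  bound is linear in \<open>\<bar>x\<bar>\<close>, so integrating it controls the truncated second
  moments by a first moment alone.\<close>

lemma sum_truncated_squares_le:
  fixes x :: real
  shows "(\<Sum>n<k. (if \<bar>x\<bar> \<le> real n then x else 0)\<^sup>2 / (real n)\<^sup>2) \<le> 2 * \<bar>x\<bar>"
proof (cases "x = 0")
  case False
  define N where "N = nat \<lceil>\<bar>x\<bar>\<rceil>"
  have N: "N \<ge> 1" "real N \<ge> \<bar>x\<bar>" using False by (auto simp: N_def) linarith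
  have "(\<Sum>n<k. (if \<bar>x\<bar> \<le> real n then x else 0)\<^sup>2 / (real n)\<^sup>2)
      = (\<Sum>n\<in>{..<k} \<inter> {N..}. x\<^sup>2 / (real n)\<^sup>2)"
    by (rule sum.mono_neutral_cong_right) (auto simp: N_def nat_le_iff ceiling_le_iff)
  also have "\<dots> \<le> (\<Sum>n=N..<N+k. x\<^sup>2 / (real n)\<^sup>2)"
    by (rule sum_mono2) auto
  also have "\<dots> = x\<^sup>2 * (\<Sum>n=N..<N+k. 1 / (real n)\<^sup>2)" by (simp add: sum_distrib_left)
  also have "\<dots> \<le> x\<^sup>2 * (2 / real N)"
    by (intro mult_left_mono sum_inverse_squares_tail_le N) auto
  also have "\<dots> = 2 * (\<bar>x\<bar> * (\<bar>x\<bar> / real N))" by (simp add: power2_eq_square)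
  also have "\<dots> \<le> 2 * (\<bar>x\<bar> * 1)" using N by (intro mult_left_mono) auto
  finally show ?thesis by simp
qed (simp add: if_distrib)

text \<open>Integrated, this is the bound of the sum of \<open>P(\<bar>X\<bar> > n)\<close> by
  \<open>E\<bar>X\<bar>\<close>. The index 0 is left out because it would count a full unit for
  every nonzero \<open>x\<close>, however small.\<close>

lemma sum_of_bool_exceeds_le:
  fixes x :: real
  shows "(\<Sum>n<k. of_bool (n \<ge> 1 \<and> \<bar>x\<bar> > real n)) \<le> \<bar>x\<bar>"
proof -
  have "(\<Sum>n<k. of_bool (n \<ge> 1 \<and> \<bar>x\<bar> > real n)) = (\<Sum>n\<in>{n\<in>{..<k}. n \<ge> 1 \<and> \<bar>x\<bar> > real n}. 1::real)"
    by (rule sum.mono_neutral_cong_right) auto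
  also have "\<dots> \<le> real (card {1..nat \<lfloor>\<bar>x\<bar>\<rfloor>})"
    unfolding real_of_card[symmetric] of_nat_le_iff
    by (intro card_mono) (auto simp: le_nat_iff le_floor_iff)
  also have "\<dots> \<le> \<bar>x\<bar>" by simp
  finally show ?thesis .
qed

text \<open>By Tonelli the sum of the series has a finite integral and is therefore finite almost
  surely. Applied to squared deviations and, in place of Borel-Cantelli, to indicators.\<close>

lemma (in prob_space) AE_summable_if_summable_expectation:
  fixes g :: "nat \<Rightarrow> 'a \<Rightarrow> real"
  assumes "\<And>n. integrable M (g n)" "\<And>n \<omega>. g n \<omega> \<ge> 0" "summable (\<lambda>n. expectation (g n))"
  shows "AE \<omega> in M. summable (\<lambda>n. g n \<omega>)"
proof -
  have [measurable]: "g n \<in> borel_measurable M" for n using assms(1) by auto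
  have E0: "expectation (g n) \<ge> 0" for n using assms(2) by (intro integral_nonneg_AE) auto
  have "(\<integral>\<^sup>+\<omega>. (\<Sum>n. ennreal (g n \<omega>)) \<partial>M) = (\<Sum>n. \<integral>\<^sup>+\<omega>. ennreal (g n \<omega>) \<partial>M)"
    by (rule nn_integral_suminf) simp
  also have "\<dots> = (\<Sum>n. ennreal (expectation (g n)))"
    using assms by (intro suminf_cong nn_integral_eq_integral) auto
  also have "\<dots> \<noteq> \<infinity>" using assms(3) E0 by (simp add: suminf_ennreal2)
  finally have "AE \<omega> in M. (\<Sum>n. ennreal (g n \<omega>)) \<noteq> \<infinity>"
    by (intro nn_integral_PInf_AE) auto
  then show ?thesis
    by eventually_elim (auto intro!: summable_suminf_not_top assms(2))
qed

section \<open>Reinforced steps as functions of the past\<close>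

lemma sum_of_bool_eq_mult:
  fixes h :: "'b \<Rightarrow> real"
  assumes "finite A" "a \<in> A"
  shows "(\<Sum>j\<in>A. of_bool (a = j) * h j) = h a"
proof -
  have "(\<Sum>j\<in>A. of_bool (a = j) * h j) = (\<Sum>j\<in>A. if a = j then h j else 0)"
    by (intro sum.cong) auto
  then show ?thesis using assms by simp
qed

text \<open>The factor \<open>s\<close> unifies the two walks (\<open>s = 1\<close> and
  \<open>s = -1\<close>), so that the moment computations are done once and the dominating positive
  walk is an instance of them.\<close>

function reinforced_step ::
  "real \<Rightarrow> (nat \<Rightarrow> real) \<Rightarrow> (nat \<Rightarrow> bool) \<Rightarrow> (nat \<Rightarrow> nat) \<Rightarrow> nat \<Rightarrow> real"
where
  "reinforced_step s x e u n =
     (if n \<ge> 2 \<and> e n \<and> u n \<in> {1..n-1} then s * reinforced_step s x e u (u n) else x n)"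
  by pat_completeness auto
termination by (relation "Wellfounded.measure (\<lambda>(s, x, e, u, n). n)") auto

declare reinforced_step.simps [simp del]

lemma pos_reinforced_step_eq: "pos_reinforced_step x e u n = reinforced_step 1 x e u n"
proof (induction n rule: less_induct)
  case (less n)
  then show ?case
    by (subst pos_reinforced_step.simps, subst reinforced_step.simps) auto
qed

lemma neg_reinforced_step_eq: "neg_reinforced_step x e u n = reinforced_step (-1) x e u n"
proof (induction n rule: less_induct)
  case (less n)
  then show ?case
    by (subst neg_reinforced_step.simps, subst reinforced_step.simps) auto
qed

text \<open>Which fresh step is copied, and how often its sign changes, depends on \<open>e\<close>
  and \<open>u\<close> only; hence a step is linear in \<open>x\<close>. This is what later splits
  the original walk into the truncated one and the altered variables.\<close>

lemma reinforced_step_diff: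
  "reinforced_step s (\<lambda>k. x k - y k) e u n = reinforced_step s x e u n - reinforced_step s y e u n"
proof (induction n rule: less_induct)
  case (less n)
  show ?case
  proof (cases "n \<ge> 2 \<and> e n \<and> u n \<in> {1..n-1}")
    case True
    then have "u n < n" by auto
    with less True show ?thesis
      by (subst (1 2 3) reinforced_step.simps) (simp add: right_diff_distrib)
  qed (subst (1 2 3) reinforced_step.simps, auto)
qed

lemma reinforced_step_sum:
  assumes "finite A"
  shows "reinforced_step s (\<lambda>k. \<Sum>i\<in>A. c i * x i k) e u n = (\<Sum>i\<in>A. c i * reinforced_step s (x i) e u n)"
proof (induction n rule: less_induct)
  case (less n)
  show ?case
  proof (cases "n \<ge> 2 \<and> e n \<and> u n \<in> {1..n-1}")
    case True
    then have rec: "reinforced_step s y e u n = s * reinforced_step s y e u (u n)" for y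
      by (subst reinforced_step.simps) simp
    from True have "u n < n" by auto
    with less show ?thesis
      by (simp add: rec sum_distrib_left mult.left_commute)
  next
    case False
    then have "reinforced_step s y e u n = y n" for y
      by (subst reinforced_step.simps) auto
    then show ?thesis by simp
  qed
qed

text \<open>Both sides follow the same chain of copies back to the same fresh step; along it the
  left side only picks up factors of modulus at most 1.\<close>

lemma abs_reinforced_step_le:
  assumes "\<bar>s\<bar> \<le> 1"
  shows "\<bar>reinforced_step s x e u n\<bar> \<le> reinforced_step 1 (\<lambda>k. \<bar>x k\<bar>) e u n"
proof (induction n rule: less_induct)
  case (less n)
  show ?case
  proof (cases "n \<ge> 2 \<and> e n \<and> u n \<in> {1..n-1}")
    case True
    then have "u n < n" by auto
    with less have IH: "\<bar>reinforced_step s x e u (u n)\<bar> \<le> reinforced_step 1 (\<lambda>k. \<bar>x k\<bar>) e u (u n)" by blast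
    have "\<bar>s * reinforced_step s x e u (u n)\<bar> \<le> 1 * reinforced_step 1 (\<lambda>k. \<bar>x k\<bar>) e u (u n)"
      unfolding abs_mult using assms IH by (intro mult_mono) auto
    with True show ?thesis
      by (subst (1 2) reinforced_step.simps) simp
  qed (subst (1 2) reinforced_step.simps, auto)
qed

lemma reinforced_step_cong:
  assumes "n \<ge> 1" "\<And>k. 1 \<le> k \<Longrightarrow> k \<le> n \<Longrightarrow> x k = x' k"
    and "\<And>k. 2 \<le> k \<Longrightarrow> k \<le> n \<Longrightarrow> e k = e' k" "\<And>k. 2 \<le> k \<Longrightarrow> k \<le> n \<Longrightarrow> u k = u' k"
  shows "reinforced_step s x e u n = reinforced_step s x' e' u' n"
  using assms
proof (induction n rule: less_induct)
  case (less n)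
  have x: "x n = x' n" using less.prems by auto
  show ?case
  proof (cases "n \<ge> 2 \<and> e n \<and> u n \<in> {1..n-1}")
    case True
    have "e n = e' n" "u n = u' n" using True less.prems by auto
    moreover have "reinforced_step s x e u (u n) = reinforced_step s x' e' u' (u n)"
      using True less.prems by (intro less.IH) auto
    ultimately show ?thesis using True
      by (subst (1 2) reinforced_step.simps) auto
  next
    case False
    then have "\<not> (n \<ge> 2 \<and> e' n \<and> u' n \<in> {1..n-1})" using less.prems by auto
    then show ?thesis using False x by (subst (1 2) reinforced_step.simps) auto
  qed
qed

text \<open>A step as a function of the source vector alone, the form to which independence of
  disjoint groups of sources applies. The test \<open>= 1\<close> and the floor undo the embeddings
  of the Boolean and natural number sources into the reals.\<close>

definition step_of_sources :: "real \<Rightarrow> (nat \<Rightarrow> real \<Rightarrow> real) \<Rightarrow> (source \<Rightarrow> real) \<Rightarrow> nat \<Rightarrow> real" where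
  "step_of_sources s f v =
     reinforced_step s (\<lambda>k. f k (v (Step k))) (\<lambda>k. v (Reinforce k) = 1) (\<lambda>k. nat \<lfloor>v (Choice k)\<rfloor>)"

definition past :: "nat \<Rightarrow> source set" where
  "past n = Step ` {1..n} \<union> Reinforce ` {2..n} \<union> Choice ` {2..n}"

lemma past_subset: "past n \<subseteq> sources"
  by (auto simp: past_def sources_def)

text \<open>A copied step has a random index. It is written as a finite sum of indicators of the
  possible indices times the earlier steps, which are measurable by induction.\<close>

lemma measurable_step_of_sources:
  assumes f[measurable]: "\<And>k. f k \<in> borel_measurable borel" and "1 \<le> i" "i \<le> n"
  shows "(\<lambda>v. step_of_sources s f v i) \<in> borel_measurable (PiM (past n) (\<lambda>_. borel))"
  using assms(2,3)
proof (induction i rule: less_induct)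
  case (less i)
  let ?P = "PiM (past n) (\<lambda>_. borel :: real measure)"
  have S[measurable]: "(\<lambda>v. v (Step i)) \<in> borel_measurable ?P"
    using less by (intro measurable_component_singleton) (auto simp: past_def)
  show ?case
  proof (cases "i \<ge> 2")
    case True
    have R[measurable]: "(\<lambda>v. v (Reinforce i)) \<in> borel_measurable ?P"
      and C[measurable]: "(\<lambda>v. v (Choice i)) \<in> borel_measurable ?P"
      using less True by (intro measurable_component_singleton; auto simp: past_def)+
    have [measurable]: "(\<lambda>v. step_of_sources s f v j) \<in> borel_measurable ?P" if "j \<in> {1..i-1}" for j
      using that less by auto
    have "(\<lambda>v. step_of_sources s f v i) = (\<lambda>v. if v (Reinforce i) = 1 \<and> nat \<lfloor>v (Choice i)\<rfloor> \<in> {1..i-1}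
        then s * (\<Sum>j\<in>{1..i-1}. of_bool (nat \<lfloor>v (Choice i)\<rfloor> = j) * step_of_sources s f v j)
        else f i (v (Step i)))"
    proof
      fix v show "step_of_sources s f v i = (if v (Reinforce i) = 1 \<and> nat \<lfloor>v (Choice i)\<rfloor> \<in> {1..i-1}
        then s * (\<Sum>j\<in>{1..i-1}. of_bool (nat \<lfloor>v (Choice i)\<rfloor> = j) * step_of_sources s f v j)
        else f i (v (Step i)))"
      proof (cases "v (Reinforce i) = 1 \<and> nat \<lfloor>v (Choice i)\<rfloor> \<in> {1..i-1}")
        case 1: True
        have "(\<Sum>j\<in>{1..i-1}. of_bool (nat \<lfloor>v (Choice i)\<rfloor> = j) * step_of_sources s f v j)
            = step_of_sources s f v (nat \<lfloor>v (Choice i)\<rfloor>)"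
          using 1 by (intro sum_of_bool_eq_mult) auto
        then show ?thesis using 1 True
          by (simp add: step_of_sources_def) (subst reinforced_step.simps, simp)
      next
        case False
        then show ?thesis
          unfolding step_of_sources_def by (subst reinforced_step.simps) auto
      qed
    qed
    also have "\<dots> \<in> borel_measurable ?P"
      by measurable
    finally show ?thesis .
  next
    case False
    then have "(\<lambda>v. step_of_sources s f v i) = (\<lambda>v. f i (v (Step i)))"
      unfolding step_of_sources_def by (subst reinforced_step.simps) auto
    then show ?thesis by simp
  qed
qed

section \<open>Expectation of one new step given the past\<close>

context step_reinforcement
begin

text \<open>The parameter \<open>f\<close> transforms fresh steps only. Its instances are the
  identity, truncation at the index, absolute values, and the indicator of a single index.\<close>

definition walk_step :: "real \<Rightarrow> (nat \<Rightarrow> real \<Rightarrow> real) \<Rightarrow> nat \<Rightarrow> 'a \<Rightarrow> real" where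
  "walk_step s f n \<omega> = reinforced_step s (\<lambda>k. f k (X k \<omega>)) (\<lambda>k. \<epsilon> k \<omega>) (\<lambda>k. U k \<omega>) n"

definition walk :: "real \<Rightarrow> (nat \<Rightarrow> real \<Rightarrow> real) \<Rightarrow> nat \<Rightarrow> 'a \<Rightarrow> real" where
  "walk s f n \<omega> = (\<Sum>k=1..n. walk_step s f k \<omega>)"

definition source_vec :: "source set \<Rightarrow> 'a \<Rightarrow> source \<Rightarrow> real" where
  "source_vec A \<omega> = restrict (\<lambda>r. source_var X \<epsilon> U r \<omega>) A"

lemma measurable_source_vec:
  "A \<subseteq> sources \<Longrightarrow> source_vec A \<in> measurable M (PiM A (\<lambda>_. borel))"
  using indep unfolding source_vec_def indep_vars_def by (auto intro!: measurable_restrict)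

lemma walk_step_eq_source_vec:
  "1 \<le> i \<Longrightarrow> i \<le> n \<Longrightarrow> walk_step s f i \<omega> = step_of_sources s f (source_vec (past n) \<omega>) i"
  unfolding walk_step_def step_of_sources_def
  by (rule reinforced_step_cong) (auto simp: source_vec_def past_def)

lemma measurable_walk_step:
  assumes "\<And>k. f k \<in> borel_measurable borel" "1 \<le> n"
  shows "walk_step s f n \<in> borel_measurable M"
proof -
  have "(\<lambda>\<omega>. step_of_sources s f (source_vec (past n) \<omega>) n) \<in> borel_measurable M"
    by (rule measurable_compose[OF measurable_source_vec[OF past_subset] measurable_step_of_sources])
      (use assms in auto)
  then show ?thesis using walk_step_eq_source_vec[of n n s f] assms(2) by (simp cong: measurable_cong)
qed

lemma measurable_walk:
  "(\<And>k. f k \<in> borel_measurable borel) \<Longrightarrow> walk s f n \<in> borel_measurable M"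
  unfolding walk_def[abs_def] by (intro borel_measurable_sum measurable_walk_step) auto

text \<open>The events "fresh" and "copy of step \<open>j\<close>" partition the space up to the
  null event that the choice leaves its range. Their indicators read only sources outside
  \<open>past n\<close>, so the random index disappears from the expectations. The function
  \<open>g\<close> will be the identity or the square.\<close>

lemma AE_walk_step_Suc:
  fixes g :: "real \<Rightarrow> real"
  assumes "n \<ge> 1"
  shows "AE \<omega> in M. g (walk_step s f (Suc n) \<omega>) = of_bool (\<not> \<epsilon> (Suc n) \<omega>) * g (f (Suc n) (X (Suc n) \<omega>))
    + (\<Sum>j=1..n. of_bool (\<epsilon> (Suc n) \<omega> \<and> U (Suc n) \<omega> = j) * g (s * walk_step s f j \<omega>))"
proof -
  have "AE \<omega> in M. U (Suc n) \<omega> \<in> {1..n}" using AE_U_range[of "Suc n"] assms by simp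
  then show ?thesis
  proof eventually_elim
    case (elim \<omega>)
    have "walk_step s f (Suc n) \<omega> =
        (if \<epsilon> (Suc n) \<omega> then s * walk_step s f (U (Suc n) \<omega>) \<omega> else f (Suc n) (X (Suc n) \<omega>))"
      unfolding walk_step_def using elim assms by (subst reinforced_step.simps) auto
    moreover have "(\<Sum>j=1..n. of_bool (U (Suc n) \<omega> = j) * g (s * walk_step s f j \<omega>))
        = g (s * walk_step s f (U (Suc n) \<omega>) \<omega>)"
      by (rule sum_of_bool_eq_mult[where h = "\<lambda>j. g (s * walk_step s f j \<omega>)", OF _ elim]) simp
    ultimately show ?case by (cases "\<epsilon> (Suc n) \<omega>") (simp_all del: sum_of_bool_mult_eq)
  qed
qed

text \<open>All factorizations of expectations below go through this rule, once within a new pair of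
  sources and once between that pair and the past.\<close>

lemma indep_sources_mult:
  fixes H G :: "(source \<Rightarrow> real) \<Rightarrow> real"
  assumes "A \<inter> B = {}" "A \<subseteq> sources" "B \<subseteq> sources"
    and "H \<in> borel_measurable (PiM A (\<lambda>_. borel))" "G \<in> borel_measurable (PiM B (\<lambda>_. borel))"
    and "integrable M (\<lambda>\<omega>. H (source_vec A \<omega>))" "integrable M (\<lambda>\<omega>. G (source_vec B \<omega>))"
  shows "integrable M (\<lambda>\<omega>. H (source_vec A \<omega>) * G (source_vec B \<omega>))"
    and "expectation (\<lambda>\<omega>. H (source_vec A \<omega>) * G (source_vec B \<omega>))
       = expectation (\<lambda>\<omega>. H (source_vec A \<omega>)) * expectation (\<lambda>\<omega>. G (source_vec B \<omega>))"
proof -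
  have "indep_var borel (H \<circ> source_vec A) borel (G \<circ> source_vec B)"
    unfolding source_vec_def[abs_def]
    by (rule indep_var_compose[OF indep_var_restrict[OF indep assms(1-3)]]) fact+
  then have iv: "indep_var borel (\<lambda>\<omega>. H (source_vec A \<omega>)) borel (\<lambda>\<omega>. G (source_vec B \<omega>))"
    by (simp add: comp_def)
  show "integrable M (\<lambda>\<omega>. H (source_vec A \<omega>) * G (source_vec B \<omega>))"
    by (rule indep_var_integrable[OF iv]) fact+
  show "expectation (\<lambda>\<omega>. H (source_vec A \<omega>) * G (source_vec B \<omega>))
       = expectation (\<lambda>\<omega>. H (source_vec A \<omega>)) * expectation (\<lambda>\<omega>. G (source_vec B \<omega>))"
    by (rule indep_var_lebesgue_integral[OF iv]) fact+
qed

lemma integrable_bounded_rv: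
  "g \<in> borel_measurable M \<Longrightarrow> (\<And>\<omega>. \<bar>g \<omega>\<bar> \<le> (B::real)) \<Longrightarrow> integrable M g"
  by (rule integrable_const_bound[where B=B]) auto

lemma expectation_reinforced:
  assumes "0 \<le> p" "p \<le> 1" "n \<ge> 2"
  shows "expectation (\<lambda>\<omega>. of_bool (\<epsilon> n \<omega>)) = p" and "expectation (\<lambda>\<omega>. of_bool (\<not> \<epsilon> n \<omega>)) = 1 - p"
proof -
  have "expectation (\<lambda>\<omega>. g (\<epsilon> n \<omega>)) = (\<integral>b. g b \<partial>measure_pmf (bernoulli_pmf p))" for g :: "bool \<Rightarrow> real"
    unfolding \<epsilon>_distr[OF assms(3), symmetric] using \<epsilon>_measurable[OF assms(3)]
    by (subst integral_distr) auto
  from this[of of_bool] this[of "\<lambda>b. of_bool (\<not> b)"] assms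
  show "expectation (\<lambda>\<omega>. of_bool (\<epsilon> n \<omega>)) = p" and "expectation (\<lambda>\<omega>. of_bool (\<not> \<epsilon> n \<omega>)) = 1 - p"
    by auto
qed

lemma expectation_choice:
  assumes "n \<ge> 2" "j \<in> {1..n-1}"
  shows "expectation (\<lambda>\<omega>. of_bool (U n \<omega> = j)) = 1 / real (n - 1)"
proof -
  have "expectation (\<lambda>\<omega>. of_bool (U n \<omega> = j)) = (\<integral>i. (of_bool (i = j) :: real) \<partial>measure_pmf (pmf_of_set {1..n-1}))"
    unfolding U_distr[OF assms(1), symmetric] using U_measurable[OF assms(1)]
    by (subst integral_distr) auto
  also have "\<dots> = (\<Sum>i\<in>{1..n-1}. of_bool (i = j)) / real (n - 1)"
    using assms by (subst integral_pmf_of_set) auto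
  also have "(\<Sum>i\<in>{1..n-1}. of_bool (i = j)) = (1::real)"
    using assms by (simp add: of_bool_def sum.delta)
  finally show ?thesis .
qed

text \<open>The event that step \<open>n + 1\<close> copies step \<open>j\<close> reads two sources
  outside \<open>past n\<close>, and these are independent of each other with probabilities
  \<open>p\<close> and \<open>1 / n\<close>.\<close>

lemma past_mult_choice:
  assumes p: "0 \<le> p" "p \<le> 1" and n: "n \<ge> 1" and j: "j \<in> {1..n}"
    and H: "H \<in> borel_measurable (PiM (past n) (\<lambda>_. borel))" "integrable M (\<lambda>\<omega>. H (source_vec (past n) \<omega>))"
  shows "integrable M (\<lambda>\<omega>. H (source_vec (past n) \<omega>) * of_bool (\<epsilon> (Suc n) \<omega> \<and> U (Suc n) \<omega> = j))"
    and "expectation (\<lambda>\<omega>. H (source_vec (past n) \<omega>) * of_bool (\<epsilon> (Suc n) \<omega> \<and> U (Suc n) \<omega> = j))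
       = expectation (\<lambda>\<omega>. H (source_vec (past n) \<omega>)) * (p / real n)"
proof -
  note [measurable] = \<epsilon>_measurable[of "Suc n"] U_measurable[of "Suc n"]
  let ?R = "Reinforce (Suc n)" and ?C = "Choice (Suc n)"
  define G where "G v = of_bool (v ?R = 1) * (of_bool (v ?C = real j) :: real)" for v
  have [measurable]: "(\<lambda>v. v ?R) \<in> borel_measurable (PiM {?R, ?C} (\<lambda>_. borel))"
    "(\<lambda>v. v ?C) \<in> borel_measurable (PiM {?R, ?C} (\<lambda>_. borel))"
    "(\<lambda>v. v ?R) \<in> borel_measurable (PiM {?R} (\<lambda>_. borel))"
    "(\<lambda>v. v ?C) \<in> borel_measurable (PiM {?C} (\<lambda>_. borel))"
    by (auto intro!: measurable_component_singleton)
  have G_eq: "G (source_vec {?R, ?C} \<omega>) = of_bool (\<epsilon> (Suc n) \<omega> \<and> U (Suc n) \<omega> = j)" for \<omega>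
    by (simp add: G_def source_vec_def)
  have G: "G \<in> borel_measurable (PiM {?R, ?C} (\<lambda>_. borel))" unfolding G_def by measurable
  have Gint: "integrable M (\<lambda>\<omega>. G (source_vec {?R, ?C} \<omega>))"
    unfolding G_eq using n by (intro integrable_bounded_rv[of _ 1]) auto
  have sub: "past n \<inter> {?R, ?C} = {}" "{?R, ?C} \<subseteq> sources" "{?R} \<subseteq> sources" "{?C} \<subseteq> sources"
    using n by (auto simp: past_def sources_def)
  have EG: "expectation (\<lambda>\<omega>. G (source_vec {?R, ?C} \<omega>)) = p / real n"
  proof -
    have "expectation (\<lambda>\<omega>. G (source_vec {?R, ?C} \<omega>))
      = expectation (\<lambda>\<omega>. of_bool (source_vec {?R} \<omega> ?R = 1) * of_bool (source_vec {?C} \<omega> ?C = real j))"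
      by (simp add: G_def source_vec_def)
    also have "\<dots> = expectation (\<lambda>\<omega>. of_bool (source_vec {?R} \<omega> ?R = 1))
        * expectation (\<lambda>\<omega>. of_bool (source_vec {?C} \<omega> ?C = real j))"
      using sub n by (intro indep_sources_mult(2) integrable_bounded_rv[of _ 1])
        (auto simp: source_vec_def)
    also have "\<dots> = p * (1 / real n)"
      using expectation_reinforced(1)[OF p, of "Suc n"] expectation_choice[of "Suc n" j] n j
      by (simp add: source_vec_def)
    finally show ?thesis by simp
  qed
  from indep_sources_mult[OF sub(1) past_subset sub(2) H(1) G H(2) Gint]
  show "integrable M (\<lambda>\<omega>. H (source_vec (past n) \<omega>) * of_bool (\<epsilon> (Suc n) \<omega> \<and> U (Suc n) \<omega> = j))"
    and "expectation (\<lambda>\<omega>. H (source_vec (past n) \<omega>) * of_bool (\<epsilon> (Suc n) \<omega> \<and> U (Suc n) \<omega> = j))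
       = expectation (\<lambda>\<omega>. H (source_vec (past n) \<omega>)) * (p / real n)"
    unfolding EG unfolding G_eq .
qed

lemma past_mult_fresh:
  assumes p: "0 \<le> p" "p \<le> 1" and n: "n \<ge> 1"
    and H: "H \<in> borel_measurable (PiM (past n) (\<lambda>_. borel))" "integrable M (\<lambda>\<omega>. H (source_vec (past n) \<omega>))"
    and h: "h \<in> borel_measurable borel" "integrable M (\<lambda>\<omega>. h (X (Suc n) \<omega>))"
  shows "integrable M (\<lambda>\<omega>. H (source_vec (past n) \<omega>) * (of_bool (\<not> \<epsilon> (Suc n) \<omega>) * h (X (Suc n) \<omega>)))"
    and "expectation (\<lambda>\<omega>. H (source_vec (past n) \<omega>) * (of_bool (\<not> \<epsilon> (Suc n) \<omega>) * h (X (Suc n) \<omega>)))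
       = expectation (\<lambda>\<omega>. H (source_vec (past n) \<omega>)) * ((1 - p) * expectation (\<lambda>\<omega>. h (X (Suc n) \<omega>)))"
proof -
  note [measurable] = \<epsilon>_measurable[of "Suc n"] X_measurable[of "Suc n"] h(1)
  let ?R = "Reinforce (Suc n)" and ?S = "Step (Suc n)"
  define G where "G v = of_bool (v ?R \<noteq> 1) * h (v ?S)" for v :: "source \<Rightarrow> real"
  have [measurable]: "(\<lambda>v. v ?R) \<in> borel_measurable (PiM {?R, ?S} (\<lambda>_. borel))"
    "(\<lambda>v. v ?S) \<in> borel_measurable (PiM {?R, ?S} (\<lambda>_. borel))"
    "(\<lambda>v. v ?R) \<in> borel_measurable (PiM {?R} (\<lambda>_. borel))"
    "(\<lambda>v. v ?S) \<in> borel_measurable (PiM {?S} (\<lambda>_. borel))"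
    by (auto intro!: measurable_component_singleton)
  have G_eq: "G (source_vec {?R, ?S} \<omega>) = of_bool (\<not> \<epsilon> (Suc n) \<omega>) * h (X (Suc n) \<omega>)" for \<omega>
    by (simp add: G_def source_vec_def)
  have G: "G \<in> borel_measurable (PiM {?R, ?S} (\<lambda>_. borel))" unfolding G_def by measurable
  have sub: "past n \<inter> {?R, ?S} = {}" "{?R, ?S} \<subseteq> sources" "{?R} \<subseteq> sources" "{?S} \<subseteq> sources"
    using n by (auto simp: past_def sources_def)
  have int_R: "integrable M (\<lambda>\<omega>. of_bool (source_vec {?R} \<omega> ?R \<noteq> 1) :: real)"
    using n by (intro integrable_bounded_rv[of _ 1]) (auto simp: source_vec_def)
  have int_S: "integrable M (\<lambda>\<omega>. h (source_vec {?S} \<omega> ?S))"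
    using h by (simp add: source_vec_def)
  have G_split: "G (source_vec {?R, ?S} \<omega>) = of_bool (source_vec {?R} \<omega> ?R \<noteq> 1) * h (source_vec {?S} \<omega> ?S)" for \<omega>
    by (simp add: G_def source_vec_def)
  have meas_R: "(\<lambda>v. of_bool (v ?R \<noteq> 1) :: real) \<in> borel_measurable (PiM {?R} (\<lambda>_. borel :: real measure))"
    and meas_S: "(\<lambda>v. h (v ?S)) \<in> borel_measurable (PiM {?S} (\<lambda>_. borel))" by measurable
  have disj: "{?R} \<inter> {?S} = {}" by simp
  note RS = indep_sources_mult[OF disj sub(3,4) meas_R meas_S int_R int_S]
  have Gint: "integrable M (\<lambda>\<omega>. G (source_vec {?R, ?S} \<omega>))"
    unfolding G_split by (rule RS)
  have EG: "expectation (\<lambda>\<omega>. G (source_vec {?R, ?S} \<omega>)) = (1 - p) * expectation (\<lambda>\<omega>. h (X (Suc n) \<omega>))"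
    unfolding G_split RS(2) using expectation_reinforced(2)[OF p, of "Suc n"] n
    by (simp add: source_vec_def)
  from indep_sources_mult[OF sub(1) past_subset sub(2) H(1) G H(2) Gint]
  show "integrable M (\<lambda>\<omega>. H (source_vec (past n) \<omega>) * (of_bool (\<not> \<epsilon> (Suc n) \<omega>) * h (X (Suc n) \<omega>)))"
    and "expectation (\<lambda>\<omega>. H (source_vec (past n) \<omega>) * (of_bool (\<not> \<epsilon> (Suc n) \<omega>) * h (X (Suc n) \<omega>)))
       = expectation (\<lambda>\<omega>. H (source_vec (past n) \<omega>)) * ((1 - p) * expectation (\<lambda>\<omega>. h (X (Suc n) \<omega>)))"
    unfolding EG unfolding G_eq .
qed

text \<open>This is the conditional expectation of a new step given the past, tested against a
  function \<open>H\<close> of the past. \<open>H = 1\<close> yields means and second moments;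
  taking \<open>H\<close> to be the walk itself yields the mixed term of the variance.
  \<open>H\<close> is in general dependent on the earlier steps, so integrability of those products
  is a premise.\<close>

lemma past_mult_walk_step:
  assumes p: "0 \<le> p" "p \<le> 1" and n: "n \<ge> 1"
    and f: "\<And>k. f k \<in> borel_measurable borel" and g: "g \<in> borel_measurable borel"
    and H: "H \<in> borel_measurable (PiM (past n) (\<lambda>_. borel))" "integrable M (\<lambda>\<omega>. H (source_vec (past n) \<omega>))"
    and fresh: "integrable M (\<lambda>\<omega>. g (f (Suc n) (X (Suc n) \<omega>)))"
    and rep: "\<And>j. j \<in> {1..n} \<Longrightarrow> integrable M (\<lambda>\<omega>. H (source_vec (past n) \<omega>) * g (s * walk_step s f j \<omega>))"
  shows "integrable M (\<lambda>\<omega>. H (source_vec (past n) \<omega>) * g (walk_step s f (Suc n) \<omega>))"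
    and "expectation (\<lambda>\<omega>. H (source_vec (past n) \<omega>) * g (walk_step s f (Suc n) \<omega>))
       = (1 - p) * (expectation (\<lambda>\<omega>. H (source_vec (past n) \<omega>)) * expectation (\<lambda>\<omega>. g (f (Suc n) (X (Suc n) \<omega>))))
         + p / real n * (\<Sum>j=1..n. expectation (\<lambda>\<omega>. H (source_vec (past n) \<omega>) * g (s * walk_step s f j \<omega>)))"
proof -
  define Z where "Z \<omega> = H (source_vec (past n) \<omega>)" for \<omega>
  define N where "N \<omega> = Z \<omega> * (of_bool (\<not> \<epsilon> (Suc n) \<omega>) * g (f (Suc n) (X (Suc n) \<omega>)))" for \<omega>
  define R where "R j \<omega> = Z \<omega> * g (s * walk_step s f j \<omega>) * of_bool (\<epsilon> (Suc n) \<omega> \<and> U (Suc n) \<omega> = j)" for j \<omega>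
  have AE: "AE \<omega> in M. Z \<omega> * g (walk_step s f (Suc n) \<omega>) = N \<omega> + (\<Sum>j=1..n. R j \<omega>)"
    using AE_walk_step_Suc[OF n, of g s f]
  proof eventually_elim
    case (elim \<omega>)
    show ?case
      unfolding elim N_def R_def distrib_left sum_distrib_left
      by (intro arg_cong2[where f = "(+)"] refl sum.cong) (simp_all add: mult_ac)
  qed
  note N = past_mult_fresh[OF p n H _ fresh, folded Z_def, folded N_def]
  have gf: "(\<lambda>x. g (f (Suc n) x)) \<in> borel_measurable borel" using f g by measurable
  have R: "integrable M (R j)" "expectation (R j) = expectation (\<lambda>\<omega>. Z \<omega> * g (s * walk_step s f j \<omega>)) * (p / real n)"
    if j: "j \<in> {1..n}" for j
  proof -
    let ?H = "\<lambda>v. H v * g (s * step_of_sources s f v j)"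
    have eq: "?H (source_vec (past n) \<omega>) = Z \<omega> * g (s * walk_step s f j \<omega>)" for \<omega>
      using j walk_step_eq_source_vec[of j n s f] by (simp add: Z_def)
    note [measurable] = g H(1)
    have [measurable]: "(\<lambda>v. step_of_sources s f v j) \<in> borel_measurable (PiM (past n) (\<lambda>_. borel))"
      using j f by (intro measurable_step_of_sources) auto
    have "?H \<in> borel_measurable (PiM (past n) (\<lambda>_. borel))" by measurable
    from past_mult_choice[OF p n j this] rep[OF j]
    show "integrable M (R j)" "expectation (R j) = expectation (\<lambda>\<omega>. Z \<omega> * g (s * walk_step s f j \<omega>)) * (p / real n)"
      unfolding eq by (simp_all add: R_def[abs_def] Z_def)
  qed
  have [measurable]: "Z \<in> borel_measurable M" using borel_measurable_integrable[OF H(2)] by (simp add: Z_def[abs_def])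
  have [measurable]: "walk_step s f (Suc n) \<in> borel_measurable M" using f by (intro measurable_walk_step) auto
  note [measurable] = g
  have int: "integrable M (\<lambda>\<omega>. N \<omega> + (\<Sum>j=1..n. R j \<omega>))"
    using N(1)[OF gf] R(1) by (intro Bochner_Integration.integrable_add Bochner_Integration.integrable_sum) auto
  have meas: "(\<lambda>\<omega>. Z \<omega> * g (walk_step s f (Suc n) \<omega>)) \<in> borel_measurable M" by measurable
  show "integrable M (\<lambda>\<omega>. H (source_vec (past n) \<omega>) * g (walk_step s f (Suc n) \<omega>))"
    unfolding Z_def[symmetric] using int AE meas by (subst integrable_cong_AE) auto
  have "expectation (\<lambda>\<omega>. Z \<omega> * g (walk_step s f (Suc n) \<omega>)) = expectation (\<lambda>\<omega>. N \<omega> + (\<Sum>j=1..n. R j \<omega>))"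
    using int AE meas by (intro integral_cong_AE) auto
  also have "\<dots> = expectation N + (\<Sum>j=1..n. expectation (R j))"
    using N(1)[OF gf] R(1)
    by (subst Bochner_Integration.integral_add) (auto intro!: Bochner_Integration.integrable_sum Bochner_Integration.integral_sum)
  also have "\<dots> = (1 - p) * (expectation Z * expectation (\<lambda>\<omega>. g (f (Suc n) (X (Suc n) \<omega>))))
         + p / real n * (\<Sum>j=1..n. expectation (\<lambda>\<omega>. Z \<omega> * g (s * walk_step s f j \<omega>)))"
    using N(2)[OF gf] R(2) by (simp add: sum_distrib_left mult_ac)
  finally show "expectation (\<lambda>\<omega>. H (source_vec (past n) \<omega>) * g (walk_step s f (Suc n) \<omega>))
       = (1 - p) * (expectation (\<lambda>\<omega>. H (source_vec (past n) \<omega>)) * expectation (\<lambda>\<omega>. g (f (Suc n) (X (Suc n) \<omega>))))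
         + p / real n * (\<Sum>j=1..n. expectation (\<lambda>\<omega>. H (source_vec (past n) \<omega>) * g (s * walk_step s f j \<omega>)))"
    unfolding Z_def .
qed

end

section \<open>First and second moments\<close>

lemma integrable_mult_if_square_integrable:
  fixes u v :: "'a \<Rightarrow> real"
  assumes "u \<in> borel_measurable M" "v \<in> borel_measurable M"
    and "integrable M (\<lambda>x. (u x)\<^sup>2)" "integrable M (\<lambda>x. (v x)\<^sup>2)"
  shows "integrable M (\<lambda>x. u x * v x)"
proof (rule Bochner_Integration.integrable_bound)
  show "integrable M (\<lambda>x. (u x)\<^sup>2 + (v x)\<^sup>2)" using assms by simp
  show "AE x in M. norm (u x * v x) \<le> norm ((u x)\<^sup>2 + (v x)\<^sup>2)"
  proof (rule AE_I2)
    fix x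
    have "2 * (\<bar>u x\<bar> * \<bar>v x\<bar>) \<le> (u x)\<^sup>2 + (v x)\<^sup>2"
      using sum_squares_bound[of "\<bar>u x\<bar>" "\<bar>v x\<bar>"] by (simp add: mult.assoc)
    moreover have "0 \<le> \<bar>u x\<bar> * \<bar>v x\<bar>" by simp
    ultimately have "\<bar>u x\<bar> * \<bar>v x\<bar> \<le> (u x)\<^sup>2 + (v x)\<^sup>2" by linarith
    then show "norm (u x * v x) \<le> norm ((u x)\<^sup>2 + (v x)\<^sup>2)"
      by (simp add: abs_mult)
  qed
qed (use assms in simp)

context step_reinforcement
begin

lemma walk_Suc: "walk s f (Suc n) \<omega> = walk s f n \<omega> + walk_step s f (Suc n) \<omega>"
  by (simp add: walk_def)

section \<open>Moment recursions for square integrable fresh steps\<close>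

context
  fixes s :: real and f :: "nat \<Rightarrow> real \<Rightarrow> real" and V :: "nat \<Rightarrow> real"
  assumes p: "0 < p" "p < 1" and s: "\<bar>s\<bar> \<le> 1"
    and f: "\<And>k. f k \<in> borel_measurable borel"
    and sq: "\<And>k. k \<ge> 1 \<Longrightarrow> integrable M (\<lambda>\<omega>. (f k (X k \<omega>))\<^sup>2)"
    and V: "\<And>k. k \<ge> 1 \<Longrightarrow> expectation (\<lambda>\<omega>. (f k (X k \<omega>))\<^sup>2) \<le> V k" "mono V"
begin

lemma fresh_integrable: "k \<ge> 1 \<Longrightarrow> integrable M (\<lambda>\<omega>. f k (X k \<omega>))"
  by (rule square_integrable_imp_integrable[OF measurable_compose[OF X_measurable f] sq])

text \<open>The second moment of a new step is \<open>1 - p\<close> times that of the fresh variable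
  plus \<open>p * s^2\<close> times the average over all earlier steps. With
  \<open>s^2 \<le> 1\<close> and \<open>V\<close> monotone, every ingredient is at most the current
  \<open>V\<close>.\<close>

lemma walk_step_square:
  "n \<ge> 1 \<Longrightarrow> integrable M (\<lambda>\<omega>. (walk_step s f n \<omega>)\<^sup>2) \<and> expectation (\<lambda>\<omega>. (walk_step s f n \<omega>)\<^sup>2) \<le> V n"
proof (induction n rule: less_induct)
  case (less n)
  show ?case
  proof (cases "n = 1")
    case True
    have "walk_step s f 1 \<omega> = f 1 (X 1 \<omega>)" for \<omega>
      unfolding walk_step_def by (subst reinforced_step.simps) simp
    then show ?thesis using True sq[of 1] V(1)[of 1] by simp
  next
    case False
    then obtain m where m: "n = Suc m" "m \<ge> 1" using less.prems by (cases n) auto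
    have IH: "integrable M (\<lambda>\<omega>. (walk_step s f j \<omega>)\<^sup>2)" "expectation (\<lambda>\<omega>. (walk_step s f j \<omega>)\<^sup>2) \<le> V (Suc m)"
      if "j \<in> {1..m}" for j
    proof -
      have *: "integrable M (\<lambda>\<omega>. (walk_step s f j \<omega>)\<^sup>2) \<and> expectation (\<lambda>\<omega>. (walk_step s f j \<omega>)\<^sup>2) \<le> V j"
        using less.IH[of j] m that by auto
      then show "integrable M (\<lambda>\<omega>. (walk_step s f j \<omega>)\<^sup>2)" by blast
      have "V j \<le> V (Suc m)" using V(2) that by (auto simp: mono_def)
      with * show "expectation (\<lambda>\<omega>. (walk_step s f j \<omega>)\<^sup>2) \<le> V (Suc m)" by linarith
    qed
    have s2: "s\<^sup>2 \<le> 1" using s by (simp add: abs_square_le_1)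
    have rep: "integrable M (\<lambda>\<omega>. 1 * (s * walk_step s f j \<omega>)\<^sup>2)" if "j \<in> {1..m}" for j
      using IH(1)[OF that] by (simp add: power_mult_distrib)
    have p01: "0 \<le> p" "p \<le> 1" using p by auto
    have H: "(\<lambda>_. 1) \<in> borel_measurable (PiM (past m) (\<lambda>_. borel :: real measure))"
      and H_int: "integrable M (\<lambda>\<omega>. 1 :: real)" and g: "(\<lambda>x::real. x\<^sup>2) \<in> borel_measurable borel"
      by simp_all
    have fresh: "integrable M (\<lambda>\<omega>. (f (Suc m) (X (Suc m) \<omega>))\<^sup>2)" by (rule sq) simp
    note step = past_mult_walk_step[where H = "\<lambda>_. 1" and g = "\<lambda>x. x\<^sup>2" and f = f and s = s and n = m,
        OF p01 m(2) f g H H_int fresh rep]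
    have int: "integrable M (\<lambda>\<omega>. (walk_step s f n \<omega>)\<^sup>2)" using step(1) by (simp add: m(1))
    have E: "expectation (\<lambda>\<omega>. (walk_step s f n \<omega>)\<^sup>2)
       = (1 - p) * expectation (\<lambda>\<omega>. (f (Suc m) (X (Suc m) \<omega>))\<^sup>2)
         + p / real m * (\<Sum>j=1..m. s\<^sup>2 * expectation (\<lambda>\<omega>. (walk_step s f j \<omega>)\<^sup>2))"
      using step(2) by (simp add: m(1) power_mult_distrib prob_space)
    have "(\<Sum>j=1..m. s\<^sup>2 * expectation (\<lambda>\<omega>. (walk_step s f j \<omega>)\<^sup>2)) \<le> (\<Sum>j=1..m. 1 * V (Suc m))"
      using IH(2) s2 by (intro sum_mono mult_mono) auto
    then have "p / real m * (\<Sum>j=1..m. s\<^sup>2 * expectation (\<lambda>\<omega>. (walk_step s f j \<omega>)\<^sup>2))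
        \<le> p / real m * (real m * V (Suc m))"
      using p by (intro mult_left_mono) auto
    also have "\<dots> = p * V (Suc m)" using m by simp
    finally have 1: "p / real m * (\<Sum>j=1..m. s\<^sup>2 * expectation (\<lambda>\<omega>. (walk_step s f j \<omega>)\<^sup>2)) \<le> p * V (Suc m)" .
    have 2: "(1 - p) * expectation (\<lambda>\<omega>. (f (Suc m) (X (Suc m) \<omega>))\<^sup>2) \<le> (1 - p) * V (Suc m)"
      using p V(1) by (intro mult_left_mono) auto
    have "expectation (\<lambda>\<omega>. (walk_step s f n \<omega>)\<^sup>2) \<le> (1 - p) * V (Suc m) + p * V (Suc m)"
      unfolding E by (rule add_mono[OF 2 1])
    also have "\<dots> = V n" by (simp add: m algebra_simps)
    finally show ?thesis using int by (simp add: m(1))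
  qed
qed

lemma walk_step_integrable: "n \<ge> 1 \<Longrightarrow> integrable M (walk_step s f n)"
  by (rule square_integrable_imp_integrable[OF measurable_walk_step[OF f] conjunct1[OF walk_step_square]])

lemma walk_square_integrable: "integrable M (\<lambda>\<omega>. (walk s f n \<omega>)\<^sup>2)"
proof (induction n)
  case (Suc n)
  have step: "integrable M (\<lambda>\<omega>. (walk_step s f (Suc n) \<omega>)\<^sup>2)" using walk_step_square[of "Suc n"] by simp
  have "integrable M (\<lambda>\<omega>. walk s f n \<omega> * walk_step s f (Suc n) \<omega>)"
    by (rule integrable_mult_if_square_integrable[OF measurable_walk[OF f] measurable_walk_step[OF f] Suc step]) simp
  from Bochner_Integration.integrable_add[OF Bochner_Integration.integrable_add[OF Suc step] integrable_mult_right[OF this, of 2]]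
  show ?case by (simp add: walk_Suc power2_sum mult.assoc)
qed (simp add: walk_def)

lemma walk_mult_step_integrable:
  "k \<ge> 1 \<Longrightarrow> integrable M (\<lambda>\<omega>. walk s f n \<omega> * walk_step s f k \<omega>)"
  by (rule integrable_mult_if_square_integrable[OF measurable_walk[OF f] measurable_walk_step[OF f]
      walk_square_integrable conjunct1[OF walk_step_square]])

lemma walk_integrable: "integrable M (walk s f n)"
  by (rule square_integrable_imp_integrable[OF measurable_walk[OF f] walk_square_integrable])

lemma expectation_walk_step_Suc:
  assumes n: "n \<ge> 1"
  shows "expectation (walk_step s f (Suc n))
    = (1 - p) * expectation (\<lambda>\<omega>. f (Suc n) (X (Suc n) \<omega>)) + p * s / real n * expectation (walk s f n)"
proof -
  have p01: "0 \<le> p" "p \<le> 1" using p by auto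
  have H: "(\<lambda>_. 1) \<in> borel_measurable (PiM (past n) (\<lambda>_. borel :: real measure))"
    and H_int: "integrable M (\<lambda>\<omega>. 1 :: real)" and g: "(\<lambda>x::real. x) \<in> borel_measurable borel"
    by simp_all
  have fresh: "integrable M (\<lambda>\<omega>. f (Suc n) (X (Suc n) \<omega>))" by (rule fresh_integrable) simp
  have rep: "integrable M (\<lambda>\<omega>. 1 * (s * walk_step s f j \<omega>))" if "j \<in> {1..n}" for j
    using walk_step_integrable[of j] that by simp
  note step = past_mult_walk_step(2)[where H = "\<lambda>_. 1" and g = "\<lambda>x. x" and f = f and s = s and n = n,
      OF p01 n f g H H_int fresh rep]
  moreover have "expectation (walk s f n) = (\<Sum>j=1..n. expectation (walk_step s f j))"
    unfolding walk_def[abs_def] using walk_step_integrable by (intro Bochner_Integration.integral_sum) auto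
  ultimately show ?thesis using step by (simp add: prob_space sum_distrib_left mult_ac)
qed

lemma expectation_walk_Suc:
  assumes "n \<ge> 1"
  shows "expectation (walk s f (Suc n))
    = (1 + p * s / real n) * expectation (walk s f n) + (1 - p) * expectation (\<lambda>\<omega>. f (Suc n) (X (Suc n) \<omega>))"
proof -
  have "expectation (walk s f (Suc n)) = expectation (walk s f n) + expectation (walk_step s f (Suc n))"
    unfolding walk_Suc[abs_def] using walk_integrable walk_step_integrable
    by (intro Bochner_Integration.integral_add) auto
  then show ?thesis using expectation_walk_step_Suc[OF assms] by (simp add: algebra_simps)
qed

text \<open>Copying picks an earlier step uniformly, so the copies average to \<open>s\<close> times
  the walk divided by \<open>n\<close>; multiplied by the walk this gives the square on the
  right.\<close>

lemma expectation_walk_mult_step: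
  assumes n: "n \<ge> 1"
  shows "expectation (\<lambda>\<omega>. walk s f n \<omega> * walk_step s f (Suc n) \<omega>)
    = (1 - p) * expectation (walk s f n) * expectation (\<lambda>\<omega>. f (Suc n) (X (Suc n) \<omega>))
      + p * s / real n * expectation (\<lambda>\<omega>. (walk s f n \<omega>)\<^sup>2)"
proof -
  let ?H = "\<lambda>v. \<Sum>i=1..n. step_of_sources s f v i"
  have eq: "?H (source_vec (past n) \<omega>) = walk s f n \<omega>" for \<omega>
    unfolding walk_def by (intro sum.cong) (auto simp: walk_step_eq_source_vec[symmetric])
  have H: "?H \<in> borel_measurable (PiM (past n) (\<lambda>_. borel))"
    using f by (intro borel_measurable_sum measurable_step_of_sources) auto
  have prod: "integrable M (\<lambda>\<omega>. walk s f n \<omega> * (s * walk_step s f j \<omega>))" if "j \<in> {1..n}" for j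
  proof -
    have "integrable M (\<lambda>\<omega>. walk s f n \<omega> * walk_step s f j \<omega>)"
      using that by (intro walk_mult_step_integrable) auto
    from integrable_mult_right[OF this, of s] show ?thesis by (simp add: mult_ac)
  qed
  have p01: "0 \<le> p" "p \<le> 1" using p by auto
  have g: "(\<lambda>x::real. x) \<in> borel_measurable borel" by simp
  have fresh: "integrable M (\<lambda>\<omega>. f (Suc n) (X (Suc n) \<omega>))" by (rule fresh_integrable) simp
  have "expectation (\<lambda>\<omega>. walk s f n \<omega> * walk_step s f (Suc n) \<omega>)
    = (1 - p) * (expectation (walk s f n) * expectation (\<lambda>\<omega>. f (Suc n) (X (Suc n) \<omega>)))
      + p / real n * (\<Sum>j=1..n. expectation (\<lambda>\<omega>. walk s f n \<omega> * (s * walk_step s f j \<omega>)))"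
    by (rule past_mult_walk_step(2)[where H = ?H and g = "\<lambda>x. x" and f = f and s = s and n = n, unfolded eq,
        OF p01 n f g H walk_integrable fresh prod])
  also have "(\<Sum>j=1..n. expectation (\<lambda>\<omega>. walk s f n \<omega> * (s * walk_step s f j \<omega>)))
      = expectation (\<lambda>\<omega>. \<Sum>j=1..n. walk s f n \<omega> * (s * walk_step s f j \<omega>))"
    using prod by (intro Bochner_Integration.integral_sum[symmetric]) auto
  also have "\<dots> = expectation (\<lambda>\<omega>. s * (walk s f n \<omega>)\<^sup>2)"
  proof (rule arg_cong[where f = expectation], rule ext)
    fix \<omega>
    have "(\<Sum>j=1..n. walk s f n \<omega> * (s * walk_step s f j \<omega>)) = walk s f n \<omega> * (s * (\<Sum>j=1..n. walk_step s f j \<omega>))"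
      by (simp add: sum_distrib_left)
    also have "\<dots> = walk s f n \<omega> * (s * walk s f n \<omega>)" unfolding walk_def ..
    finally show "(\<Sum>j=1..n. walk s f n \<omega> * (s * walk_step s f j \<omega>)) = s * (walk s f n \<omega>)\<^sup>2"
      by (simp add: power2_eq_square)
  qed
  finally show ?thesis by simp
qed

text \<open>The products of mean and fresh contribution cancel, leaving exactly
  \<open>(1 + 2 * p * s / n)\<close> times the old variance plus the variance of the new step. The
  latter is at most its second moment, and \<open>p * s \<le> p\<close> replaces the factor by its
  value at \<open>s = 1\<close>.\<close>

lemma variance_walk_Suc_le:
  assumes n: "n \<ge> 1"
  shows "variance (walk s f (Suc n)) \<le> (1 + 2 * p / real n) * variance (walk s f n) + V (Suc n)"
proof -
  define m where "m = expectation (walk s f n)"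
  define q where "q = expectation (\<lambda>\<omega>. (walk s f n \<omega>)\<^sup>2)"
  define c where "c = (1 - p) * expectation (\<lambda>\<omega>. f (Suc n) (X (Suc n) \<omega>))"
  define r where "r = expectation (\<lambda>\<omega>. (walk_step s f (Suc n) \<omega>)\<^sup>2)"
  have int: "integrable M (\<lambda>\<omega>. walk s f n \<omega> * walk_step s f (Suc n) \<omega>)"
    by (rule walk_mult_step_integrable) simp
  have "expectation (\<lambda>\<omega>. (walk s f (Suc n) \<omega>)\<^sup>2)
     = expectation (\<lambda>\<omega>. (walk s f n \<omega>)\<^sup>2 + (walk_step s f (Suc n) \<omega>)\<^sup>2
        + 2 * (walk s f n \<omega> * walk_step s f (Suc n) \<omega>))"
    by (simp add: walk_Suc power2_sum mult.assoc)
  also have "\<dots> = q + r + 2 * expectation (\<lambda>\<omega>. walk s f n \<omega> * walk_step s f (Suc n) \<omega>)"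
    using int walk_square_integrable walk_step_square[of "Suc n"] by (simp add: q_def r_def)
  also have "expectation (\<lambda>\<omega>. walk s f n \<omega> * walk_step s f (Suc n) \<omega>) = m * c + p * s / real n * q"
    unfolding expectation_walk_mult_step[OF n] m_def c_def q_def by simp
  finally have E2: "expectation (\<lambda>\<omega>. (walk s f (Suc n) \<omega>)\<^sup>2) = q + r + 2 * (m * c + p * s / real n * q)" .
  have E1: "expectation (walk s f (Suc n)) = m + (p * s / real n * m + c)"
    unfolding expectation_walk_Suc[OF n] m_def c_def by (simp add: algebra_simps)
  have var: "variance (walk s f n) = q - m\<^sup>2"
    unfolding q_def m_def by (rule variance_eq[OF walk_integrable walk_square_integrable])
  have "variance (walk s f (Suc n)) = expectation (\<lambda>\<omega>. (walk s f (Suc n) \<omega>)\<^sup>2) - (expectation (walk s f (Suc n)))\<^sup>2"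
    by (rule variance_eq[OF walk_integrable walk_square_integrable])
  also have "\<dots> = q + r + 2 * (m * c + p * s / real n * q) - (m + (p * s / real n * m + c))\<^sup>2"
    unfolding E2 E1 ..
  also have "\<dots> = (1 + 2 * (p * s / real n)) * (q - m\<^sup>2) + r - (p * s / real n * m + c)\<^sup>2"
    unfolding power2_eq_square by algebra
  also have "\<dots> \<le> (1 + 2 * p / real n) * (q - m\<^sup>2) + V (Suc n)"
  proof -
    have "p * s \<le> p * 1" using p s by (intro mult_left_mono) auto
    then have "1 + 2 * (p * s / real n) \<le> 1 + 2 * p / real n" using n by (simp add: divide_right_mono)
    moreover have "q - m\<^sup>2 \<ge> 0" unfolding var[symmetric] by simp
    ultimately have "(1 + 2 * (p * s / real n)) * (q - m\<^sup>2) \<le> (1 + 2 * p / real n) * (q - m\<^sup>2)"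
      by (rule mult_right_mono)
    moreover have "r \<le> V (Suc n)" using walk_step_square[of "Suc n"] by (simp add: r_def)
    moreover have "(p * s / real n * m + c)\<^sup>2 \<ge> 0" by simp
    ultimately show ?thesis by linarith
  qed
  finally show ?thesis unfolding var .
qed

lemma AE_summable_walk_deviation:
  assumes "summable (\<lambda>n. V n / (real n)\<^sup>2)"
  shows "AE \<omega> in M. summable (\<lambda>n. (walk s f n \<omega> / real n - expectation (walk s f n) / real n)\<^sup>2 / real (Suc n))"
proof -
  define w where "w n = variance (walk s f n) / (real n)\<^sup>2" for n
  have w: "w n \<ge> 0" for n by (simp add: w_def)
  have V0: "V (Suc n) \<ge> 0" for n by (rule order.trans[OF _ V(1)]) simp_all
  have sm: "summable (\<lambda>n. w n / real (Suc n))"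
  proof (rule summable_div_Suc_if_recursive_le[where \<theta> = "1 - p" and r = "\<lambda>n. V (Suc n) / (real (Suc n))\<^sup>2" and N = 1])
    show "summable (\<lambda>n. V (Suc n) / (real (Suc n))\<^sup>2)" using assms by (subst summable_Suc_iff)
    show "w (Suc n) \<le> (1 - (1 - p) / real (Suc n)) * w n + V (Suc n) / (real (Suc n))\<^sup>2" if n: "1 \<le> n" for n
    proof -
      have n0: "real n \<ge> 1" using n by simp
      have "w (Suc n) \<le> ((1 + 2 * p / real n) * variance (walk s f n) + V (Suc n)) / (real (Suc n))\<^sup>2"
        unfolding w_def using variance_walk_Suc_le[OF n] by (intro divide_right_mono) auto
      also have "\<dots> = (1 + 2 * p / real n) * (real n)\<^sup>2 / (real (Suc n))\<^sup>2 * w n + V (Suc n) / (real (Suc n))\<^sup>2"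
        using n by (simp add: w_def add_divide_distrib)
      \<comment> \<open>Here \<open>n^2 + 2 * p * n = (n + 1)^2 - 2 * (1 - p) * n - 1\<close>. Using
        only \<open>(1 - p) * (n + 1)\<close> of the deficit leaves the nonnegative remainder
        \<open>(1 - p) * (n - 1) + 1\<close>; this is the origin of the rate
        \<open>1 - p\<close>.\<close>
      also have "(1 + 2 * p / real n) * (real n)\<^sup>2 / (real (Suc n))\<^sup>2 \<le> 1 - (1 - p) / real (Suc n)"
      proof -
        define x where "x = real n"
        have "(1 + 2 * p / x) * x\<^sup>2 = (x + 1)\<^sup>2 - (1 - p) * (x + 1) - ((1 - p) * (x - 1) + 1)"
          using n0 by (simp add: x_def power2_eq_square field_simps)
        also have "\<dots> \<le> (x + 1)\<^sup>2 - (1 - p) * (x + 1)"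
        proof -
          have "(1 - p) * (x - 1) \<ge> 0" using p n0 by (simp add: x_def)
          then show ?thesis by simp
        qed
        also have "\<dots> = (1 - (1 - p) / (x + 1)) * (x + 1)\<^sup>2"
          using n0 by (simp add: x_def power2_eq_square field_simps)
        finally show ?thesis using n0 by (simp add: x_def pos_divide_le_eq add.commute)
      qed
      finally show ?thesis using w[of n] by (simp add: mult_right_mono)
    qed
  qed (use p w V0 in auto)
  show ?thesis
  proof (rule AE_summable_if_summable_expectation)
    have *: "(walk s f n \<omega> / real n - expectation (walk s f n) / real n)\<^sup>2 / real (Suc n)
        = (walk s f n \<omega> - expectation (walk s f n))\<^sup>2 / (real n)\<^sup>2 / real (Suc n)" for n \<omega>
      by (simp add: diff_divide_distrib[symmetric] power_divide)
    have "integrable M (\<lambda>\<omega>. (walk s f n \<omega>)\<^sup>2 + (expectation (walk s f n))\<^sup>2 - 2 * walk s f n \<omega> * expectation (walk s f n))" for n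
      using walk_square_integrable walk_integrable by simp
    then have "integrable M (\<lambda>\<omega>. (walk s f n \<omega> - expectation (walk s f n))\<^sup>2)" for n
      unfolding power2_diff .
    then show "integrable M (\<lambda>\<omega>. (walk s f n \<omega> / real n - expectation (walk s f n) / real n)\<^sup>2 / real (Suc n))" for n
      unfolding * by (intro integrable_divide)
    show "summable (\<lambda>n. expectation (\<lambda>\<omega>. (walk s f n \<omega> / real n - expectation (walk s f n) / real n)\<^sup>2 / real (Suc n)))"
      using sm unfolding * w_def by simp
  qed simp
qed

text \<open>After division by \<open>n + 1\<close> the mean recursion is a weighted average with
  \<open>\<theta> = 1 - p * s\<close>, which lies in \<open>(0, 2)\<close> because
  \<open>\<bar>p * s\<bar> < 1\<close>. The factor \<open>(1 - p) / (1 - p * s)\<close> is what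
  normalizes the inhomogeneous term to weight \<open>\<theta> / (n + 1)\<close>.\<close>

lemma expectation_walk_div_tendsto:
  assumes "(\<lambda>n. expectation (\<lambda>\<omega>. f (Suc n) (X (Suc n) \<omega>))) \<longlonglongrightarrow> \<mu>"
  shows "(\<lambda>n. expectation (walk s f n) / real n) \<longlonglongrightarrow> (1 - p) / (1 - p * s) * \<mu>"
proof (rule tendsto_weighted_average)
  have "\<bar>p * s\<bar> \<le> p * 1" unfolding abs_mult using p s by (intro mult_mono) auto
  then have ps: "p * s < 1" "p * s > -1" using p by auto
  then show "0 < 1 - p * s" "1 - p * s < 2" by auto
  show "(\<lambda>n. (1 - p) / (1 - p * s) * expectation (\<lambda>\<omega>. f (Suc n) (X (Suc n) \<omega>))) \<longlonglongrightarrow> (1 - p) / (1 - p * s) * \<mu>"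
    by (intro tendsto_intros assms)
  fix n :: nat assume n: "1 \<le> n"
  define m where "m = expectation (walk s f n)"
  define c where "c = (1 - p) * expectation (\<lambda>\<omega>. f (Suc n) (X (Suc n) \<omega>))"
  have "expectation (walk s f (Suc n)) = (1 + p * s / real n) * m + c"
    unfolding m_def c_def by (rule expectation_walk_Suc[OF n])
  moreover have "((1 + p * s / real n) * m + c) / real (Suc n) =
     (1 - (1 - p * s) / real (Suc n)) * (m / real n) + c / real (Suc n)"
  proof -
    have "(1 + p * s / real n) * m = (real n + p * s) * (m / real n)" using n by (simp add: field_simps)
    moreover have "1 - (1 - p * s) / real (Suc n) = (real n + p * s) / real (Suc n)" by (simp add: field_simps)
    ultimately show ?thesis by (simp only: add_divide_distrib[of _ c] times_divide_eq_left)
  qed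
  moreover have "(1 - p * s) / real (Suc n) * ((1 - p) / (1 - p * s) * expectation (\<lambda>\<omega>. f (Suc n) (X (Suc n) \<omega>)))
      = c / real (Suc n)"
    using ps by (simp add: c_def)
  ultimately show "expectation (walk s f (Suc n)) / real (Suc n) =
     (1 - (1 - p * s) / real (Suc n)) * (expectation (walk s f n) / real n)
     + (1 - p * s) / real (Suc n) * ((1 - p) / (1 - p * s) * expectation (\<lambda>\<omega>. f (Suc n) (X (Suc n) \<omega>)))"
    by (simp only: m_def)
qed

end

text \<open>Neither walk need be monotone, but the positively reinforced walk with steps \<open>\<bar>f k (X k)\<bar>\<close>
  dominates the increments of the other one, so that their sum and difference are.\<close>

lemma AE_walk_div_tendsto:
  assumes p: "0 < p" "p < 1" and s: "\<bar>s\<bar> \<le> 1"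
    and f: "\<And>k. f k \<in> borel_measurable borel"
    and sq: "\<And>k. k \<ge> 1 \<Longrightarrow> integrable M (\<lambda>\<omega>. (f k (X k \<omega>))\<^sup>2)"
    and V: "\<And>k. k \<ge> 1 \<Longrightarrow> expectation (\<lambda>\<omega>. (f k (X k \<omega>))\<^sup>2) \<le> V k" "mono V"
      "summable (\<lambda>n. V n / (real n)\<^sup>2)"
    and lim: "(\<lambda>n. expectation (\<lambda>\<omega>. f (Suc n) (X (Suc n) \<omega>))) \<longlonglongrightarrow> \<mu>"
      "(\<lambda>n. expectation (\<lambda>\<omega>. \<bar>f (Suc n) (X (Suc n) \<omega>)\<bar>)) \<longlonglongrightarrow> \<nu>"
  shows "AE \<omega> in M. (\<lambda>n. walk s f n \<omega> / real n) \<longlonglongrightarrow> (1 - p) / (1 - p * s) * \<mu>"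
proof -
  define g where "g k x = \<bar>f k x\<bar>" for k x
  have g: "g k \<in> borel_measurable borel" for k using f[of k] unfolding g_def[abs_def] by measurable
  have gsq: "(g k x)\<^sup>2 = (f k x)\<^sup>2" for k x by (simp add: g_def)
  define a where "a n = expectation (walk s f n) / real n" for n
  define b where "b n = expectation (walk 1 g n) / real n" for n
  define \<alpha> where "\<alpha> = (1 - p) / (1 - p * s) * \<mu>"
  define \<beta> where "\<beta> = (1 - p) / (1 - p * 1) * \<nu>"
  have a: "a \<longlonglongrightarrow> \<alpha>" unfolding a_def[abs_def] \<alpha>_def
    by (rule expectation_walk_div_tendsto[of s f V]) (use p s f sq V lim in auto)
  have b: "b \<longlonglongrightarrow> \<beta>" unfolding b_def[abs_def] \<beta>_def
    by (rule expectation_walk_div_tendsto[of 1 g V]) (use p g sq V lim in \<open>auto simp: gsq g_def\<close>)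
  have dev_S: "AE \<omega> in M. summable (\<lambda>n. (walk s f n \<omega> / real n - a n)\<^sup>2 / real (Suc n))" unfolding a_def
    by (rule AE_summable_walk_deviation[of s f V]) (use p s f sq V in auto)
  have dev_T: "AE \<omega> in M. summable (\<lambda>n. (walk 1 g n \<omega> / real n - b n)\<^sup>2 / real (Suc n))" unfolding b_def
    by (rule AE_summable_walk_deviation[of 1 g V]) (use p g sq V in \<open>auto simp: gsq\<close>)
  have le: "\<bar>walk_step s f n \<omega>\<bar> \<le> walk_step 1 g n \<omega>" for n \<omega>
    unfolding walk_step_def g_def by (rule abs_reinforced_step_le[OF s])
  have mono: "mono (\<lambda>n. walk 1 g n \<omega> + t * walk s f n \<omega>)" and nonneg: "walk 1 g n \<omega> + t * walk s f n \<omega> \<ge> 0"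
    if t: "\<bar>t\<bar> = 1" for t n \<omega>
  proof -
    have *: "walk_step 1 g n \<omega> + t * walk_step s f n \<omega> \<ge> 0" for n
    proof -
      have "\<bar>t * walk_step s f n \<omega>\<bar> \<le> walk_step 1 g n \<omega>" using le t by (simp add: abs_mult)
      then show ?thesis by linarith
    qed
    show "mono (\<lambda>n. walk 1 g n \<omega> + t * walk s f n \<omega>)"
      by (rule mono_iff_le_Suc[THEN iffD2]) (use * in \<open>simp add: walk_Suc distrib_left\<close>)
    have "walk 1 g n \<omega> + t * walk s f n \<omega> = (\<Sum>k=1..n. walk_step 1 g k \<omega> + t * walk_step s f k \<omega>)"
      by (simp add: walk_def sum.distrib sum_distrib_left)
    also have "\<dots> \<ge> 0" using * by (intro sum_nonneg)
    finally show "walk 1 g n \<omega> + t * walk s f n \<omega> \<ge> 0" .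
  qed
  have intS: "integrable M (walk s f n)" for n
    by (rule walk_integrable[of s f V]) (use p s f sq V in auto)
  have intT: "integrable M (walk 1 g n)" for n
    by (rule walk_integrable[of 1 g V]) (use p g sq V in \<open>auto simp: gsq\<close>)
  \<comment> \<open>The convergence criterion for monotone sequences requires a nonnegative limit;
    it is inherited from the expectations of the nonnegative walks.\<close>
  have nonneg_lim: "\<beta> + t * \<alpha> \<ge> 0" if t: "\<bar>t\<bar> = 1" for t
  proof (rule tendsto_lowerbound)
    show "(\<lambda>n. b n + t * a n) \<longlonglongrightarrow> \<beta> + t * \<alpha>" by (intro tendsto_intros a b)
    have "b n + t * a n = expectation (\<lambda>\<omega>. walk 1 g n \<omega> + t * walk s f n \<omega>) / real n" for n
      using intS intT by (simp add: a_def b_def add_divide_distrib)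
    then show "\<forall>\<^sub>F n in sequentially. 0 \<le> b n + t * a n"
      using nonneg[OF t] by (auto intro!: always_eventually divide_nonneg_nonneg)
  qed simp
  from dev_S dev_T have "AE \<omega> in M. (\<lambda>n. walk s f n \<omega> / real n) \<longlonglongrightarrow> \<alpha>"
  proof eventually_elim
    case (elim \<omega>)
    have lim: "(\<lambda>n. (walk 1 g n \<omega> + t * walk s f n \<omega>) / real n) \<longlonglongrightarrow> \<beta> + t * \<alpha>" if t: "\<bar>t\<bar> = 1" for t
    proof (rule mono_div_tendsto_if_summable_sq[OF mono[OF t] nonneg[OF t] _ nonneg_lim[OF t]])
      show "(\<lambda>n. b n + t * a n) \<longlonglongrightarrow> \<beta> + t * \<alpha>" by (intro tendsto_intros a b)
      have sm: "summable (\<lambda>n. 2 * ((walk 1 g n \<omega> / real n - b n)\<^sup>2 / real (Suc n))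
          + 2 * ((walk s f n \<omega> / real n - a n)\<^sup>2 / real (Suc n)))"
        using elim by (intro summable_add summable_mult)
      show "summable (\<lambda>n. ((walk 1 g n \<omega> + t * walk s f n \<omega>) / real n - (b n + t * a n))\<^sup>2 / real (Suc n))"
      proof (rule summable_comparison_test'[OF sm])
        fix n :: nat
        define x where "x = walk 1 g n \<omega> / real n - b n"
        define y where "y = walk s f n \<omega> / real n - a n"
        have "t = 1 \<or> t = -1" using t by auto
        \<comment> \<open>The parallelogram law: the deviation of the combined walk is controlled by
          the two convergent series separately.\<close>
        then have "(x + t * y)\<^sup>2 + (x - t * y)\<^sup>2 = 2 * x\<^sup>2 + 2 * y\<^sup>2"
          by (auto simp: power2_eq_square algebra_simps)
        moreover have "(x - t * y)\<^sup>2 \<ge> 0" by simp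
        ultimately have "(x + t * y)\<^sup>2 \<le> 2 * x\<^sup>2 + 2 * y\<^sup>2" by linarith
        moreover have "(walk 1 g n \<omega> + t * walk s f n \<omega>) / real n - (b n + t * a n) = x + t * y"
          by (simp add: x_def y_def add_divide_distrib algebra_simps)
        ultimately show "norm (((walk 1 g n \<omega> + t * walk s f n \<omega>) / real n - (b n + t * a n))\<^sup>2 / real (Suc n))
           \<le> 2 * ((walk 1 g n \<omega> / real n - b n)\<^sup>2 / real (Suc n))
          + 2 * ((walk s f n \<omega> / real n - a n)\<^sup>2 / real (Suc n))"
          unfolding x_def[symmetric] y_def[symmetric]
          by (simp add: add_divide_distrib[symmetric] divide_right_mono)
      qed
    qed
    have "(\<lambda>n. ((walk 1 g n \<omega> + 1 * walk s f n \<omega>) / real n - (walk 1 g n \<omega> + (-1) * walk s f n \<omega>) / real n) / 2)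
        \<longlonglongrightarrow> ((\<beta> + 1 * \<alpha>) - (\<beta> + (-1) * \<alpha>)) / 2"
      by (intro tendsto_intros lim) auto
    moreover have "((walk 1 g n \<omega> + 1 * walk s f n \<omega>) / real n - (walk 1 g n \<omega> + (-1) * walk s f n \<omega>) / real n) / 2
        = walk s f n \<omega> / real n" for n
      by (simp add: diff_divide_distrib add_divide_distrib)
    ultimately show ?case by simp
  qed
  then show ?thesis by (simp add: \<alpha>_def)
qed

end

section \<open>Truncation\<close>

definition truncate :: "nat \<Rightarrow> real \<Rightarrow> real" where
  "truncate k x = (if \<bar>x\<bar> \<le> real k then x else 0)"

lemma measurable_truncate[measurable]: "truncate k \<in> borel_measurable borel"
  unfolding truncate_def[abs_def] by measurable

lemma abs_truncate_le: "\<bar>truncate k x\<bar> \<le> \<bar>x\<bar>" "\<bar>truncate k x\<bar> \<le> real k"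
  by (auto simp: truncate_def)

lemma truncate_square_mono: "k \<le> l \<Longrightarrow> (truncate k x)\<^sup>2 \<le> (truncate l x)\<^sup>2"
  by (auto simp: truncate_def)

lemma truncate_tendsto: "(\<lambda>k. truncate (Suc k) x) \<longlonglongrightarrow> x"
proof (rule tendsto_eventually)
  show "\<forall>\<^sub>F k in sequentially. truncate (Suc k) x = x"
    using eventually_ge_at_top[of "nat \<lceil>\<bar>x\<bar>\<rceil>"]
    by eventually_elim (auto simp: truncate_def nat_le_iff ceiling_le_iff)
qed

context step_reinforcement
begin

declare One_nat_def [simp del]

lemma
  fixes h :: "real \<Rightarrow> real"
  assumes "h \<in> borel_measurable borel" "n \<ge> 1"
  shows expectation_X_eq: "expectation (\<lambda>\<omega>. h (X n \<omega>)) = expectation (\<lambda>\<omega>. h (X 1 \<omega>))"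
    and integrable_X_iff: "integrable M (\<lambda>\<omega>. h (X n \<omega>)) \<longleftrightarrow> integrable M (\<lambda>\<omega>. h (X 1 \<omega>))"
proof -
  note meas = X_measurable[OF assms(2)] X_measurable[of 1, OF order.refl]
  show "expectation (\<lambda>\<omega>. h (X n \<omega>)) = expectation (\<lambda>\<omega>. h (X 1 \<omega>))"
    using integral_distr[OF meas(1) assms(1)] integral_distr[OF meas(2) assms(1)] X_distr[OF assms(2)] by simp
  show "integrable M (\<lambda>\<omega>. h (X n \<omega>)) \<longleftrightarrow> integrable M (\<lambda>\<omega>. h (X 1 \<omega>))"
    using integrable_distr_eq[OF meas(1) assms(1)] integrable_distr_eq[OF meas(2) assms(1)] X_distr[OF assms(2)] by simp
qed

text \<open>\<open>V k\<close>, the second moment of \<open>X 1\<close> truncated at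
  \<open>k\<close>, increases with the level, and its sum against \<open>1 / n^2\<close> is at most
  \<open>2 * E\<bar>X 1\<bar>\<close>. The truncated means, with and without absolute values,
  converge by dominated convergence.\<close>

lemma AE_truncated_walk_div_tendsto:
  assumes p: "0 < p" "p < 1" and s: "\<bar>s\<bar> \<le> 1" and X1: "integrable M (X 1)"
  shows "AE \<omega> in M. (\<lambda>n. walk s truncate n \<omega> / real n) \<longlonglongrightarrow> (1 - p) / (1 - p * s) * expectation (X 1)"
proof -
  note [measurable] = X_measurable[of 1, OF order.refl]
  define V where "V k = expectation (\<lambda>\<omega>. (truncate k (X 1 \<omega>))\<^sup>2)" for k
  have int: "integrable M (\<lambda>\<omega>. (truncate k (X 1 \<omega>))\<^sup>2)" for k
  proof (rule integrable_const_bound[where B = "(real k)\<^sup>2"])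
    show "AE \<omega> in M. norm ((truncate k (X 1 \<omega>))\<^sup>2) \<le> (real k)\<^sup>2"
    proof (rule AE_I2)
      fix \<omega>
      show "norm ((truncate k (X 1 \<omega>))\<^sup>2) \<le> (real k)\<^sup>2"
        using power_mono[OF abs_truncate_le(2)[of k "X 1 \<omega>"], of 2] by simp
    qed
  qed measurable
  have sq: "(\<lambda>x. (truncate k x)\<^sup>2) \<in> borel_measurable borel" for k by measurable
  have "mono V"
    unfolding V_def[abs_def] by (intro monoI integral_mono int truncate_square_mono)
  have V_summable: "summable (\<lambda>n. V n / (real n)\<^sup>2)"
  proof (rule summableI_nonneg_bounded)
    fix k
    show "0 \<le> V k / (real k)\<^sup>2" by (simp add: V_def)
    have "(\<Sum>n<k. V n / (real n)\<^sup>2) = expectation (\<lambda>\<omega>. \<Sum>n<k. (truncate n (X 1 \<omega>))\<^sup>2 / (real n)\<^sup>2)"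
      unfolding V_def using int by (subst Bochner_Integration.integral_sum) auto
    also have "\<dots> \<le> expectation (\<lambda>\<omega>. 2 * \<bar>X 1 \<omega>\<bar>)"
    proof (rule integral_mono)
      show "integrable M (\<lambda>\<omega>. \<Sum>n<k. (truncate n (X 1 \<omega>))\<^sup>2 / (real n)\<^sup>2)"
        using int by (intro Bochner_Integration.integrable_sum integrable_divide)
      show "integrable M (\<lambda>\<omega>. 2 * \<bar>X 1 \<omega>\<bar>)" using X1 by simp
    qed (use sum_truncated_squares_le in \<open>simp add: truncate_def\<close>)
    finally show "(\<Sum>n<k. V n / (real n)\<^sup>2) \<le> expectation (\<lambda>\<omega>. 2 * \<bar>X 1 \<omega>\<bar>)" .
  qed
  have trunc: "integrable M (\<lambda>\<omega>. (truncate k (X k \<omega>))\<^sup>2)" "expectation (\<lambda>\<omega>. (truncate k (X k \<omega>))\<^sup>2) \<le> V k"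
    if "k \<ge> 1" for k
    using integrable_X_iff[OF sq that, of k] expectation_X_eq[OF sq that, of k] int[of k] by (simp_all add: V_def)
  have lim: "(\<lambda>n. expectation (\<lambda>\<omega>. truncate (Suc n) (X (Suc n) \<omega>))) \<longlonglongrightarrow> expectation (X 1)"
  proof -
    have "(\<lambda>n. expectation (\<lambda>\<omega>. truncate (Suc n) (X 1 \<omega>))) \<longlonglongrightarrow> expectation (X 1)"
      by (rule integral_dominated_convergence[where w = "\<lambda>\<omega>. \<bar>X 1 \<omega>\<bar>"])
        (use X1 in \<open>auto simp: truncate_tendsto abs_truncate_le\<close>)
    moreover have "expectation (\<lambda>\<omega>. truncate (Suc n) (X (Suc n) \<omega>)) = expectation (\<lambda>\<omega>. truncate (Suc n) (X 1 \<omega>))" for n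
      by (rule expectation_X_eq) simp_all
    ultimately show ?thesis by presburger
  qed
  have lim_abs: "(\<lambda>n. expectation (\<lambda>\<omega>. \<bar>truncate (Suc n) (X (Suc n) \<omega>)\<bar>)) \<longlonglongrightarrow> expectation (\<lambda>\<omega>. \<bar>X 1 \<omega>\<bar>)"
  proof -
    have "(\<lambda>n. expectation (\<lambda>\<omega>. \<bar>truncate (Suc n) (X 1 \<omega>)\<bar>)) \<longlonglongrightarrow> expectation (\<lambda>\<omega>. \<bar>X 1 \<omega>\<bar>)"
      by (rule integral_dominated_convergence[where w = "\<lambda>\<omega>. \<bar>X 1 \<omega>\<bar>"])
        (use X1 in \<open>auto intro!: tendsto_rabs simp: truncate_tendsto abs_truncate_le\<close>)
    moreover have "expectation (\<lambda>\<omega>. \<bar>truncate (Suc n) (X (Suc n) \<omega>)\<bar>) = expectation (\<lambda>\<omega>. \<bar>truncate (Suc n) (X 1 \<omega>)\<bar>)" for n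
      by (rule expectation_X_eq) simp_all
    ultimately show ?thesis by presburger
  qed
  show ?thesis
    by (rule AE_walk_div_tendsto[OF p s measurable_truncate trunc \<open>mono V\<close> V_summable lim lim_abs])
qed

text \<open>This walk counts, with powers of \<open>s\<close> as weights, the steps descending from
  the \<open>i\<close>-th fresh one. Its second moments are bounded by 1, and the fresh means vanish
  beyond index \<open>i\<close>, so the limit is 0.\<close>

lemma AE_single_step_walk_div_tendsto_0:
  assumes p: "0 < p" "p < 1" and s: "\<bar>s\<bar> \<le> 1"
  shows "AE \<omega> in M. (\<lambda>n. walk s (\<lambda>k _. of_bool (k = i)) n \<omega> / real n) \<longlonglongrightarrow> 0"
proof -
  have lim: "(\<lambda>n. of_bool (Suc n = i) :: real) \<longlonglongrightarrow> 0"
  proof (rule tendsto_eventually)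
    show "\<forall>\<^sub>F n in sequentially. of_bool (Suc n = i) = (0::real)"
      using eventually_ge_at_top[of i] by eventually_elim auto
  qed
  have "summable (\<lambda>n. 1 / (real n)\<^sup>2)"
    using inverse_power_summable[of 2, where 'a = real] by (simp add: inverse_eq_divide)
  then have "AE \<omega> in M. (\<lambda>n. walk s (\<lambda>k _. of_bool (k = i)) n \<omega> / real n) \<longlonglongrightarrow> (1 - p) / (1 - p * s) * 0"
    by (intro AE_walk_div_tendsto[OF p s, where V = "\<lambda>_. 1" and \<nu> = 0])
      (use lim in \<open>auto simp: prob_space mono_def\<close>)
  then show ?thesis by simp
qed

text \<open>The indicators of \<open>\<bar>X n\<bar> > n\<close> have summable expectations by
  identical distribution and the first moment. An almost surely convergent series of indicators has
  only finitely many terms equal to 1.\<close>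

lemma AE_eventually_truncate_eq:
  assumes X1: "integrable M (X 1)"
  shows "AE \<omega> in M. \<forall>\<^sub>F n in sequentially. truncate n (X n \<omega>) = X n \<omega>"
proof -
  define g where "g n \<omega> = (of_bool (n \<ge> 1 \<and> \<bar>X n \<omega>\<bar> > real n) :: real)" for n \<omega>
  define h where "h n x = (of_bool (n \<ge> 1 \<and> \<bar>x\<bar> > real n) :: real)" for n x
  have h[measurable]: "h n \<in> borel_measurable borel" for n unfolding h_def[abs_def] by measurable
  note [measurable] = X_measurable[of 1, OF order.refl]
  have int_h: "integrable M (\<lambda>\<omega>. h n (X 1 \<omega>))" for n
    by (rule integrable_bounded_rv[of _ 1]) (auto simp: h_def[abs_def])
  have g_h: "g n = (\<lambda>\<omega>. h n (X n \<omega>))" for n by (simp add: g_def h_def fun_eq_iff)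
  have g: "integrable M (g n) \<and> expectation (g n) = expectation (\<lambda>\<omega>. h n (X 1 \<omega>))" for n
  proof (cases "n = 0")
    case True
    then show ?thesis by (simp add: g_def[abs_def] h_def)
  next
    case False
    then have "n \<ge> 1" by simp
    then show ?thesis
      unfolding g_h using expectation_X_eq[OF h] integrable_X_iff[OF h] int_h by blast
  qed
  have "AE \<omega> in M. summable (\<lambda>n. g n \<omega>)"
  proof (rule AE_summable_if_summable_expectation)
    show "summable (\<lambda>n. expectation (g n))"
    proof (rule summableI_nonneg_bounded)
      fix k
      show "0 \<le> expectation (g k)" by (simp add: g_def)
      have "(\<Sum>n<k. expectation (g n)) = expectation (\<lambda>\<omega>. \<Sum>n<k. h n (X 1 \<omega>))"
        using g int_h by (subst Bochner_Integration.integral_sum) auto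
      also have "\<dots> \<le> expectation (\<lambda>\<omega>. \<bar>X 1 \<omega>\<bar>)"
      proof (rule integral_mono)
        show "integrable M (\<lambda>\<omega>. \<Sum>n<k. h n (X 1 \<omega>))"
          using int_h by (intro Bochner_Integration.integrable_sum)
        show "integrable M (\<lambda>\<omega>. \<bar>X 1 \<omega>\<bar>)" using X1 by simp
        show "(\<Sum>n<k. h n (X 1 \<omega>)) \<le> \<bar>X 1 \<omega>\<bar>" for \<omega>
          unfolding h_def by (rule sum_of_bool_exceeds_le)
      qed
      finally show "(\<Sum>n<k. expectation (g n)) \<le> expectation (\<lambda>\<omega>. \<bar>X 1 \<omega>\<bar>)" .
    qed
    show "integrable M (g n)" for n using g by blast
    show "0 \<le> g n \<omega>" for n \<omega> by (simp add: g_def)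
  qed
  then show ?thesis
  proof eventually_elim
    case (elim \<omega>)
    from order_tendstoD(2)[OF summable_LIMSEQ_zero[OF elim], of 1]
    have "\<forall>\<^sub>F n in sequentially. g n \<omega> < 1" by simp
    then show ?case
      using eventually_ge_at_top[of 1]
    proof eventually_elim
      case (elim n)
      then have "\<not> \<bar>X n \<omega>\<bar> > real n" by (auto simp: g_def)
      then show ?case by (simp add: truncate_def)
    qed
  qed
qed

text \<open>On a fixed path the difference of the fresh steps is a finite combination of index
  indicators whose coefficients are numbers, and linearity of the recursion carries this over to the
  walks.\<close>

lemma walk_eq_truncated_walk_plus:
  assumes N: "\<And>n. n \<ge> N \<Longrightarrow> truncate n (X n \<omega>) = X n \<omega>"
  shows "walk s (\<lambda>_ x. x) n \<omega> = walk s truncate n \<omega>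
    + (\<Sum>i<N. (X i \<omega> - truncate i (X i \<omega>)) * walk s (\<lambda>k _. of_bool (k = i)) n \<omega>)"
proof -
  define d where "d i = X i \<omega> - truncate i (X i \<omega>)" for i
  have diff: "X k \<omega> - truncate k (X k \<omega>) = (\<Sum>i<N. d i * of_bool (k = i))" for k
  proof -
    have "(\<Sum>i<N. d i * of_bool (k = i)) = (\<Sum>i<N. if k = i then d i else 0)"
      by (intro sum.cong) auto
    then show ?thesis using N[of k] by (auto simp: d_def not_less)
  qed
  have "walk_step s (\<lambda>_ x. x) k \<omega> - walk_step s truncate k \<omega>
     = (\<Sum>i<N. d i * walk_step s (\<lambda>k _. of_bool (k = i)) k \<omega>)" for k
    unfolding walk_step_def reinforced_step_diff[symmetric] diff by (rule reinforced_step_sum) simp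
  then have "walk s (\<lambda>_ x. x) n \<omega> - walk s truncate n \<omega>
     = (\<Sum>k=1..n. \<Sum>i<N. d i * walk_step s (\<lambda>k _. of_bool (k = i)) k \<omega>)"
    by (simp add: walk_def sum_subtractf[symmetric])
  also have "\<dots> = (\<Sum>i<N. d i * walk s (\<lambda>k _. of_bool (k = i)) n \<omega>)"
    by (subst sum.swap) (simp add: walk_def sum_distrib_left)
  finally show ?thesis by (simp add: d_def)
qed

lemma AE_reinforced_walk_div_tendsto:
  assumes p: "0 < p" "p < 1" and s: "\<bar>s\<bar> \<le> 1" and X1: "integrable M (X 1)"
  shows "AE \<omega> in M. (\<lambda>n. walk s (\<lambda>_ x. x) n \<omega> / real n) \<longlonglongrightarrow> (1 - p) / (1 - p * s) * expectation (X 1)"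
proof -
  \<comment> \<open>The bound \<open>N\<close> below depends on the path, so the null sets of all
    indices are first combined by countability.\<close>
  have "AE \<omega> in M. \<forall>i. (\<lambda>n. walk s (\<lambda>k _. of_bool (k = i)) n \<omega> / real n) \<longlonglongrightarrow> 0"
    unfolding AE_all_countable using AE_single_step_walk_div_tendsto_0[OF p s] by blast
  with AE_truncated_walk_div_tendsto[OF p s X1] AE_eventually_truncate_eq[OF X1] show ?thesis
  proof eventually_elim
    case (elim \<omega>)
    then obtain N where N: "\<And>n. n \<ge> N \<Longrightarrow> truncate n (X n \<omega>) = X n \<omega>"
      by (auto simp: eventually_sequentially)
    let ?d = "\<lambda>i. X i \<omega> - truncate i (X i \<omega>)" and ?w = "\<lambda>i n. walk s (\<lambda>k _. of_bool (k = i)) n \<omega>"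
    have "(\<lambda>n. walk s truncate n \<omega> / real n + (\<Sum>i<N. ?d i * (?w i n / real n)))
        \<longlonglongrightarrow> (1 - p) / (1 - p * s) * expectation (X 1) + (\<Sum>i<N. ?d i * 0)"
      using elim by (intro tendsto_intros) auto
    moreover have "walk s (\<lambda>_ x. x) n \<omega> / real n = walk s truncate n \<omega> / real n + (\<Sum>i<N. ?d i * (?w i n / real n))" for n
      by (subst walk_eq_truncated_walk_plus[OF N]) (simp_all add: add_divide_distrib sum_divide_distrib)
    ultimately show ?case by simp
  qed
qed

end

theorem theorem1p1:
  fixes M :: "'a measure"
    and p :: real
    and X :: "nat \<Rightarrow> 'a \<Rightarrow> real"
    and \<epsilon> :: "nat \<Rightarrow> 'a \<Rightarrow> bool"
    and U :: "nat \<Rightarrow> 'a \<Rightarrow> nat"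
  assumes "step_reinforcement M p X \<epsilon> U"
    and "0 < p" and "p < 1"
    and "integrable M (X 1)"
  shows "(AE \<omega> in M. (\<lambda>n. S_hat X \<epsilon> U n \<omega> / real n)
            \<longlonglongrightarrow> (\<integral>\<omega>. X 1 \<omega> \<partial>M))
       \<and> (AE \<omega> in M. (\<lambda>n. S_check X \<epsilon> U n \<omega> / real n)
            \<longlonglongrightarrow> (1 - p) / (1 + p) * (\<integral>\<omega>. X 1 \<omega> \<partial>M))"
proof -
  interpret step_reinforcement M p X \<epsilon> U by fact
  have "S_hat X \<epsilon> U n \<omega> = walk 1 (\<lambda>_ x. x) n \<omega>" "S_check X \<epsilon> U n \<omega> = walk (-1) (\<lambda>_ x. x) n \<omega>" for n \<omega>
    by (simp_all add: S_hat_def S_check_def walk_def X_hat_def X_check_def walk_step_def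
        pos_reinforced_step_eq neg_reinforced_step_eq)
  moreover have "(1 - p) / (1 - p * 1) = 1" "(1 - p) / (1 - p * (-1)) = (1 - p) / (1 + p)"
    using \<open>p < 1\<close> by simp_all
  ultimately show ?thesis
    using AE_reinforced_walk_div_tendsto[of 1] AE_reinforced_walk_div_tendsto[of "-1"] assms(2-4) by simp
qed

end
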